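(* Let $\mathcal{M}=h\mathcal{K}_u$ be a nonzero proper nearly $S^*$-invariant subspace, where $u$ is a nonconstant inner function with $u(0)=0$. For $\varphi,\psi\in L^\infty(\mathbb{T})$, $$D_\varphi^{\mathcal{M}}D_\psi^{\mathcal{M}}=0$$ if and only if $\varphi=0$ almost everywhere on $\mathbb{T}$ or $\psi=0$ almost everywhere on $\mathbb{T}$.
   Context: $\mathbb{D}$ is the open unit disk, $\mathbb{T}=\partial\mathbb{D}$, and $L^2(\mathbb{T})$ is taken with respect to normalized Lebesgue measure $m$, with inner product linear in the first variable. $H^2\subset L^2(\mathbb{T})$ is the Hardy space (functions with vanishing negative Fourier coefficients, also viewed as analytic functions on $\mathbb{D}$). For $f\in H^2$, $S^*f=(f-f(0))/z$. For an inner function $u$, $\mathcal{K}_u=H^2\ominus uH^2$. A closed subspace $\mathcal{M}\subset H^2$ is nearly $S^*$-invariant if $f\in\mathcal{M}$, $f(0)=0$ imply $S^*f\in\mathcal{M}$. In writing $\mathcal{M}=h\mathcal{K}_u$ it is understood that $h\in\mathcal{M}$ is the extremal function of $\mathcal{M}$: $\|h\|_2=1$, $h(0)>0$, $h\perp\{f\in\mathcal{M}:f(0)=0\}$, and multiplication by $h$ is an isometry from $\mathcal{K}_u$ onto $\mathcal{M}$. $\mathcal{M}^\perp=L^2(\mathbb{T})\ominus\mathcal{M}$, and $P_{\mathcal{M}^\perp}$ is the orthogonal projection of $L^2(\mathbb{T})$ onto it. For $\varphi\in L^\infty(\mathbb{T})$, $D_\varphi^{\mathcal{M}}:\mathcal{M}^\perp\to\mathcal{M}^\perp$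 is defined by $D_\varphi^{\mathcal{M}}f=P_{\mathcal{M}^\perp}(\varphi f)$. *)

theory Defs
  imports "HOL-Analysis.Analysis"
begin

text \<open>
  Elements of \<open>L\<^sup>2(\<T>)\<close> are represented by measurable functions on the unit circle, and equality
  of elements is always stated almost everywhere.
\<close>

definition circle_measure :: "complex measure" where
  "circle_measure =
     distr (uniform_measure lborel {0..2 * pi}) (restrict_space borel (sphere 0 1)) cis"

definition L2T :: "(complex \<Rightarrow> complex) set" where
  "L2T = {f \<in> borel_measurable circle_measure.
            integrable circle_measure (\<lambda>z. (cmod (f z))\<^sup>2)}"

definition LinfT :: "(complex \<Rightarrow> complex) set" where
  "LinfT = {f \<in> borel_measurable circle_measure.
              \<exists>C. AE z in circle_measure. cmod (f z) \<le> C}"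

definition L2_inner :: "(complex \<Rightarrow> complex) \<Rightarrow> (complex \<Rightarrow> complex) \<Rightarrow> complex" where
  "L2_inner f g = (\<integral>z. f z * cnj (g z) \<partial>circle_measure)"

definition L2_norm :: "(complex \<Rightarrow> complex) \<Rightarrow> real" where
  "L2_norm f = sqrt (\<integral>z. (cmod (f z))\<^sup>2 \<partial>circle_measure)"

definition fourier_coeff :: "(complex \<Rightarrow> complex) \<Rightarrow> int \<Rightarrow> complex" where
  "fourier_coeff f n = L2_inner f (\<lambda>z. z powi n)"

definition H2 :: "(complex \<Rightarrow> complex) set" where
  "H2 = {f \<in> L2T. \<forall>n<0. fourier_coeff f n = 0}"

text \<open>
  The analytic function on the unit disk whose boundary function is \<open>f \<in> H\<^sup>2\<close>.  The notation
  \<open>f(0)\<close> for such \<open>f\<close> means \<open>disk_ext f 0\<close>, not the value at \<open>0\<close> of the representative \<open>f\<close>.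
\<close>
definition disk_ext :: "(complex \<Rightarrow> complex) \<Rightarrow> complex \<Rightarrow> complex" where
  "disk_ext f w = (\<Sum>n. fourier_coeff f (int n) * w ^ n)"

definition backward_shift :: "(complex \<Rightarrow> complex) \<Rightarrow> complex \<Rightarrow> complex" where
  "backward_shift f = (\<lambda>z. (f z - disk_ext f 0) / z)"

definition inner_function :: "(complex \<Rightarrow> complex) \<Rightarrow> bool" where
  "inner_function u \<longleftrightarrow> u \<in> H2 \<inter> LinfT \<and> (AE z in circle_measure. cmod (u z) = 1)"

definition orth_in :: "(complex \<Rightarrow> complex) set \<Rightarrow> (complex \<Rightarrow> complex) set
    \<Rightarrow> (complex \<Rightarrow> complex) set" where
  "orth_in X N = {f \<in> X. \<forall>g\<in>N. L2_inner f g = 0}"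

definition model_space :: "(complex \<Rightarrow> complex) \<Rightarrow> (complex \<Rightarrow> complex) set" where
  "model_space u = orth_in H2 {(\<lambda>z. u z * g z) |g. g \<in> H2}"

text \<open>Closedness under almost-everywhere equality of measurable functions follows from the last clause.\<close>
definition closed_subspace_L2 :: "(complex \<Rightarrow> complex) set \<Rightarrow> bool" where
  "closed_subspace_L2 M \<longleftrightarrow>
     M \<subseteq> L2T \<and> (\<lambda>_. 0) \<in> M \<and>
     (\<forall>f\<in>M. \<forall>g\<in>M. (\<lambda>z. f z + g z) \<in> M) \<and>
     (\<forall>f\<in>M. \<forall>c. (\<lambda>z. c * f z) \<in> M) \<and>
     (\<forall>F. \<forall>f\<in>L2T. (\<forall>n::nat. F n \<in> M) \<and> (\<lambda>n. L2_norm (\<lambda>z. F n z - f z)) \<longlonglongrightarrow> 0 \<longrightarrow> f \<in> M)"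

definition nearly_invariant :: "(complex \<Rightarrow> complex) set \<Rightarrow> bool" where
  "nearly_invariant M \<longleftrightarrow>
     closed_subspace_L2 M \<and> M \<subseteq> H2 \<and>
     (\<forall>f\<in>M. disk_ext f 0 = 0 \<longrightarrow> backward_shift f \<in> M)"

definition extremal_function :: "(complex \<Rightarrow> complex) set \<Rightarrow> (complex \<Rightarrow> complex) \<Rightarrow> bool" where
  "extremal_function M h \<longleftrightarrow>
     h \<in> M \<and> L2_norm h = 1 \<and>
     disk_ext h 0 \<in> \<real> \<and> Re (disk_ext h 0) > 0 \<and>
     (\<forall>f\<in>M. disk_ext f 0 = 0 \<longrightarrow> L2_inner h f = 0)"

definition mult_isometry_onto :: "(complex \<Rightarrow> complex) \<Rightarrow> (complex \<Rightarrow> complex) set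
    \<Rightarrow> (complex \<Rightarrow> complex) set \<Rightarrow> bool" where
  "mult_isometry_onto h K M \<longleftrightarrow>
     (\<forall>f\<in>K. (\<lambda>z. h z * f z) \<in> M \<and> L2_norm (\<lambda>z. h z * f z) = L2_norm f) \<and>
     (\<forall>g\<in>M. \<exists>f\<in>K. AE z in circle_measure. g z = h z * f z)"

text \<open>
  For a closed subspace \<open>N\<close> and \<open>f \<in> L\<^sup>2\<close> the element characterised here exists and is unique up
  to almost-everywhere equality; the choice only selects a representative.
\<close>
definition orth_proj :: "(complex \<Rightarrow> complex) set \<Rightarrow> (complex \<Rightarrow> complex)
    \<Rightarrow> (complex \<Rightarrow> complex)" where
  "orth_proj N f = (SOME p. p \<in> N \<and> (\<forall>g\<in>N. L2_inner (\<lambda>z. f z - p z) g = 0))"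

text \<open>An operator on \<open>M\<^sup>\<bottom>\<close>; only its values there are meaningful.\<close>
definition dual_toeplitz :: "(complex \<Rightarrow> complex) set \<Rightarrow> (complex \<Rightarrow> complex)
    \<Rightarrow> (complex \<Rightarrow> complex) \<Rightarrow> (complex \<Rightarrow> complex)" where
  "dual_toeplitz M \<phi> f = orth_proj (orth_in L2T M) (\<lambda>z. \<phi> z * f z)"

end

theory Submission
  imports Defs
begin

text \<open>
  Let \<open>M\<close> be a nonzero closed subspace of \<open>H\<^sup>2\<close> and \<open>P\<close> the orthogonal projection onto it.
  If \<open>f\<close> is orthogonal to \<open>M\<close>, then \<open>D\<^sub>\<psi> f = \<psi> f - q\<close> with \<open>q = P (\<psi> f)\<close>, and \<open>D\<^sub>\<phi> D\<^sub>\<psi> f = 0\<close> says that \<open>\<phi> (\<psi> f - q)\<close> belongs to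
  \<open>M\<close>, and so to \<open>H\<^sup>2\<close>.

  The first consequence is \<open>\<phi> \<psi> = 0\<close> (\<open>dual_toeplitz_product_zero_symbols\<close>).  The functions
  \<open>f = z\<^sup>-\<^sup>n\<close> with \<open>n > 0\<close> are orthogonal to \<open>M\<close>, and \<open>P (\<psi> z\<^sup>-\<^sup>n)\<close> tends to zero because even the
  \<open>H\<^sup>2\<close>-component of \<open>\<psi> z\<^sup>-\<^sup>n\<close> does (\<open>shift_tends_to_zero_on_H2\<close>); multiplying by \<open>z\<^sup>n\<close> and letting
  \<open>n\<close> grow, all Fourier coefficients of \<open>\<phi> \<psi>\<close> vanish.

  Suppose now that neither symbol is zero.  As \<open>\<phi> \<psi> = 0\<close>, each of them vanishes on a set of positive
  measure.  A nonzero function in \<open>H\<^sup>2\<close> does not (\<open>H2_zero_set_dichotomy\<close>).  For \<open>f\<close> orthogonal to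
  \<open>M\<close> the function \<open>\<phi> q = - \<phi> (\<psi> f - q)\<close> is in \<open>H\<^sup>2\<close>, so it is zero; then \<open>q\<close> vanishes where \<open>\<phi>\<close>
  does not, so \<open>q = 0\<close>.  In other words, \<open>\<psi>\<close> multiplies \<open>M\<^sup>\<bottom>\<close> into itself.  Testing with the functions
  \<open>z\<^sup>-\<^sup>n\<close> again, the conjugate of \<open>\<psi>\<close> multiplies \<open>M\<close> into \<open>H\<^sup>2\<close>, and the same argument gives \<open>M = 0\<close>.

  The zero set dichotomy, and the existence of the projections, are obtained from two facts: the
  completeness of \<open>L\<^sup>2\<close> (\<open>Riesz_Fischer_circle\<close>) and the uniqueness of the Fourier coefficients of
  integrable functions (\<open>fourier_uniqueness\<close>).
\<close>

section \<open>The normalized Lebesgue measure of the circle\<close>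

lemma sets_circle_measure [measurable_cong]:
  "sets circle_measure = sets (restrict_space borel (sphere 0 1))"
  by (simp add: circle_measure_def)

lemma space_circle_measure [simp]: "space circle_measure = sphere 0 1"
  by (simp add: circle_measure_def space_restrict_space)

lemma measurable_cis [measurable]:
  "cis \<in> measurable (uniform_measure lborel {0..2 * pi}) (restrict_space borel (sphere 0 1))"
proof -
  have "cis \<in> borel_measurable borel"
    by (intro borel_measurable_continuous_onI continuous_intros)
  then have "cis \<in> borel_measurable (uniform_measure lborel {0..2 * pi})"
    by (simp cong: measurable_cong_sets)
  then show ?thesis
    by (intro measurable_restrict_space2) auto
qed

lemma emeasure_circle [simp]: "emeasure circle_measure (sphere 0 1) = 1"
proof -
  have "cis -` sphere 0 1 = UNIV"
    by auto
  then show ?thesis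
    unfolding circle_measure_def
    by (subst emeasure_distr)
       (auto simp: sets_restrict_space space_uniform_measure intro!: emeasure_uniform_measure_1)
qed

interpretation circle: finite_measure circle_measure
  by (rule finite_measureI) simp

lemma measure_circle [simp]: "measure circle_measure (sphere 0 1) = 1"
  by (simp add: measure_def)

lemma borel_measurable_circle_continuous:
  fixes f :: "complex \<Rightarrow> 'a::topological_space"
  assumes "continuous_on (sphere 0 1) f"
  shows "f \<in> borel_measurable circle_measure"
  using borel_measurable_continuous_on_restrict[OF assms]
  by (simp cong: measurable_cong_sets add: sets_circle_measure)

lemma borel_measurable_circle_id [measurable]: "(\<lambda>z. z) \<in> borel_measurable circle_measure"
  by (rule borel_measurable_circle_continuous) (rule continuous_on_id)

lemma borel_measurable_circle_powi [measurable]: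
  "(\<lambda>z. z powi n) \<in> borel_measurable circle_measure"
  by (rule borel_measurable_circle_continuous) (auto intro!: continuous_intros)

lemma AE_circle: "AE z in circle_measure. z \<in> sphere 0 1"
  using AE_space[of circle_measure] by simp

lemma cnj_circle: "cmod z = 1 \<Longrightarrow> cnj z = inverse z"
  by (simp add: complex_eq_iff cmod_power2[symmetric])

lemma cnj_powi_circle: "cmod z = 1 \<Longrightarrow> cnj (z powi n) = z powi (-n)"
  by (simp add: cnj_circle power_int_minus power_int_inverse)

lemma borel_measurable_cnj [measurable]:
  "f \<in> borel_measurable M \<Longrightarrow> (\<lambda>z. cnj (f z)) \<in> borel_measurable M"
  by (rule borel_measurable_continuous_on[OF _ , of cnj]) (auto intro!: continuous_intros)

lemma cmod_add_sq: "(cmod (a + b))\<^sup>2 = (cmod a)\<^sup>2 + (cmod b)\<^sup>2 + 2 * Re (a * cnj b)"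
  unfolding cmod_power2 by (simp add: power2_eq_square algebra_simps)

lemma integral_powi_circle:
  assumes "n \<noteq> 0"
  shows "(\<integral>z. z powi n \<partial>circle_measure) = 0"
proof -
  define F where "F t = cis (of_int n * t) / (\<i> * of_int n)" for t
  have "(\<lambda>z::complex. z powi n) \<in> borel_measurable (restrict_space borel (sphere 0 1))"
    using borel_measurable_circle_powi[of n] by (simp cong: measurable_cong_sets add: sets_circle_measure)
  then have "(\<integral>z. z powi n \<partial>circle_measure)
      = (\<integral>t. cis (of_int n * t) \<partial>uniform_measure lborel {0..2 * pi})"
    unfolding circle_measure_def by (subst integral_distr) (auto simp: cis_power_int)
  also have "uniform_measure lborel {0..2 * pi}
      = density lborel (\<lambda>t. ennreal (indicator {0..2 * pi} t / (2 * pi)))"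
    unfolding uniform_measure_def
    by (intro density_cong) (auto simp: indicator_def divide_ennreal simp flip: ennreal_1)
  also have "(\<integral>t. cis (of_int n * t) \<partial>\<dots>)
      = (\<integral>t. indicator {0..2 * pi} t *\<^sub>R (cis (of_int n * t) / (2 * pi)) \<partial>lborel)"
  proof (subst integral_density)
    show "(\<lambda>t. cis (of_int n * t)) \<in> borel_measurable lborel"
      by (auto intro!: borel_measurable_continuous_onI continuous_intros)
  qed (auto simp: scaleR_conv_of_real)
  also have "\<dots> = F (2 * pi) / (2 * pi) - F 0 / (2 * pi)"
  proof (rule integral_FTC_Icc)
    show "((\<lambda>t. F t / (2 * pi)) has_vector_derivative cis (of_int n * t) / (2 * pi))
        (at t within {0..2 * pi})" for t
      unfolding F_def has_vector_derivative_def using assms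
      by (auto intro!: derivative_eq_intros simp: field_simps scaleR_conv_of_real)
  qed (auto intro!: continuous_intros)
  also have "\<dots> = 0"
    using cis_multiple_2pi[of "of_int n"] by (simp add: F_def mult_ac)
  finally show ?thesis .
qed

section \<open>Square-integrable functions\<close>

lemma L2T_measurable [measurable_dest]: "f \<in> L2T \<Longrightarrow> f \<in> borel_measurable circle_measure"
  by (simp add: L2T_def)

lemma LinfT_measurable [measurable_dest]: "f \<in> LinfT \<Longrightarrow> f \<in> borel_measurable circle_measure"
  by (simp add: LinfT_def)

lemma L2T_integrable_sq: "f \<in> L2T \<Longrightarrow> integrable circle_measure (\<lambda>z. (cmod (f z))\<^sup>2)"
  by (simp add: L2T_def)

lemma integrable_mult_L2T:
  assumes "f \<in> L2T" "g \<in> L2T"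
  shows "integrable circle_measure (\<lambda>z. f z * g z)"
proof (rule Bochner_Integration.integrable_bound)
  show "integrable circle_measure (\<lambda>z. (cmod (f z))\<^sup>2 + (cmod (g z))\<^sup>2)"
    using assms by (intro Bochner_Integration.integrable_add L2T_integrable_sq)
  have "cmod (f z * g z) \<le> (cmod (f z))\<^sup>2 + (cmod (g z))\<^sup>2" for z
  proof -
    have "2 * (cmod (f z) * cmod (g z)) \<le> (cmod (f z))\<^sup>2 + (cmod (g z))\<^sup>2"
      using zero_le_power2[of "cmod (f z) - cmod (g z)"] by (simp add: power2_diff)
    moreover have "0 \<le> cmod (f z) * cmod (g z)"
      by simp
    ultimately show ?thesis
      unfolding norm_mult by linarith
  qed
  then show "AE z in circle_measure.
      cmod (f z * g z) \<le> norm ((cmod (f z))\<^sup>2 + (cmod (g z))\<^sup>2)"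
    by (intro AE_I2) (simp add: order_trans[OF _ abs_ge_self])
qed (use assms in measurable)

lemma L2T_cnj: "f \<in> L2T \<Longrightarrow> (\<lambda>z. cnj (f z)) \<in> L2T"
  by (auto simp: L2T_def intro: borel_measurable_cnj)

lemma integrable_inner: "f \<in> L2T \<Longrightarrow> g \<in> L2T \<Longrightarrow> integrable circle_measure (\<lambda>z. f z * cnj (g z))"
  by (intro integrable_mult_L2T L2T_cnj)

lemma integrable_cmod_mult:
  "f \<in> L2T \<Longrightarrow> g \<in> L2T \<Longrightarrow> integrable circle_measure (\<lambda>z. cmod (f z) * cmod (g z))"
  using integrable_norm[OF integrable_mult_L2T[of f g]] by (simp add: norm_mult)

lemma L2T_add:
  assumes "f \<in> L2T" "g \<in> L2T"
  shows "(\<lambda>z. f z + g z) \<in> L2T"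
proof -
  have "integrable circle_measure
      (\<lambda>z. (cmod (f z))\<^sup>2 + (cmod (g z))\<^sup>2 + 2 * Re (f z * cnj (g z)))"
    using assms by (intro Bochner_Integration.integrable_add L2T_integrable_sq
        integrable_mult_right integrable_Re integrable_inner)
  then show ?thesis
    using assms by (auto simp: L2T_def cmod_add_sq del: times_complex.sel)
qed

lemma L2T_mult_Linf:
  assumes "f \<in> L2T" "\<phi> \<in> LinfT"
  shows "(\<lambda>z. \<phi> z * f z) \<in> L2T"
proof -
  obtain C where C: "AE z in circle_measure. cmod (\<phi> z) \<le> C"
    using assms by (auto simp: LinfT_def)
  have "integrable circle_measure (\<lambda>z. (cmod (\<phi> z * f z))\<^sup>2)"
  proof (rule Bochner_Integration.integrable_bound)
    show "integrable circle_measure (\<lambda>z. C\<^sup>2 * (cmod (f z))\<^sup>2)"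
      using assms by (intro integrable_mult_right L2T_integrable_sq)
    show "AE z in circle_measure. norm ((cmod (\<phi> z * f z))\<^sup>2) \<le> norm (C\<^sup>2 * (cmod (f z))\<^sup>2)"
      using C by eventually_elim (auto simp: norm_mult power_mult_distrib intro!: mult_right_mono power_mono)
  qed (use assms in measurable)
  then show ?thesis
    using assms by (auto simp: L2T_def LinfT_def)
qed

lemma LinfT_const: "(\<lambda>_. c) \<in> LinfT"
  by (auto simp: LinfT_def)

lemma LinfT_cnj: "f \<in> LinfT \<Longrightarrow> (\<lambda>z. cnj (f z)) \<in> LinfT"
  by (auto simp: LinfT_def intro: borel_measurable_cnj)

lemma LinfT_powi: "(\<lambda>z. z powi n) \<in> LinfT"
  using AE_circle by (auto simp: LinfT_def norm_power_int intro!: exI[of _ 1])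

lemma LinfT_subset_L2T:
  assumes "f \<in> LinfT" shows "f \<in> L2T"
proof -
  have "(\<lambda>_. 1) \<in> L2T"
    by (simp add: L2T_def)
  from L2T_mult_Linf[OF this assms] show ?thesis
    by simp
qed

lemma L2T_scale: "f \<in> L2T \<Longrightarrow> (\<lambda>z. c * f z) \<in> L2T"
  by (rule L2T_mult_Linf) (auto intro: LinfT_const)

lemma L2T_diff:
  assumes "f \<in> L2T" "g \<in> L2T"
  shows "(\<lambda>z. f z - g z) \<in> L2T"
  using L2T_add[OF assms(1) L2T_scale[OF assms(2), of "-1"]] by simp

lemma L2_inner_add_left:
  "f \<in> L2T \<Longrightarrow> f' \<in> L2T \<Longrightarrow> g \<in> L2T \<Longrightarrow>
    L2_inner (\<lambda>z. f z + f' z) g = L2_inner f g + L2_inner f' g"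
  by (simp add: L2_inner_def distrib_right integrable_inner)

lemma L2_inner_diff_left:
  "f \<in> L2T \<Longrightarrow> f' \<in> L2T \<Longrightarrow> g \<in> L2T \<Longrightarrow>
    L2_inner (\<lambda>z. f z - f' z) g = L2_inner f g - L2_inner f' g"
  by (simp add: L2_inner_def left_diff_distrib integrable_inner)

lemma L2_inner_scale_left: "L2_inner (\<lambda>z. c * f z) g = c * L2_inner f g"
  by (simp add: L2_inner_def mult.assoc)

lemma L2_inner_commute: "L2_inner g f = cnj (L2_inner f g)"
  unfolding L2_inner_def Bochner_Integration.integral_cnj[symmetric] by (simp add: mult.commute)

lemma L2_inner_scale_right: "L2_inner f (\<lambda>z. c * g z) = cnj c * L2_inner f g"
  using L2_inner_scale_left[of c g f] by (metis L2_inner_commute complex_cnj_mult)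

lemma L2_inner_cong_AE:
  assumes "AE z in circle_measure. f z = f' z" "AE z in circle_measure. g z = g' z"
    "f \<in> borel_measurable circle_measure" "f' \<in> borel_measurable circle_measure"
    "g \<in> borel_measurable circle_measure" "g' \<in> borel_measurable circle_measure"
  shows "L2_inner f g = L2_inner f' g'"
  unfolding L2_inner_def
  by (rule integral_cong_AE) (use assms in \<open>measurable, auto\<close>)

lemma L2_inner_shift:
  "L2_inner (\<lambda>z. z powi n * f z) g = L2_inner f (\<lambda>z. z powi (-n) * g z)"
  unfolding L2_inner_def
  by (rule Bochner_Integration.integral_cong) (simp_all add: power_int_minus cnj_circle power_int_inverse)

lemma L2_inner_mult_left:
  "L2_inner (\<lambda>z. \<phi> z * f z) g = L2_inner f (\<lambda>z. cnj (\<phi> z) * g z)"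
  unfolding L2_inner_def
  by (rule Bochner_Integration.integral_cong) (simp_all)

lemma L2_norm_sq: "(L2_norm f)\<^sup>2 = (\<integral>z. (cmod (f z))\<^sup>2 \<partial>circle_measure)"
  by (simp add: L2_norm_def)

lemma L2_norm_nonneg [simp]: "0 \<le> L2_norm f"
  by (simp add: L2_norm_def)

lemma L2_inner_self: "L2_inner f f = complex_of_real ((L2_norm f)\<^sup>2)"
  unfolding L2_inner_def L2_norm_sq complex_norm_square[symmetric] by (subst integral_complex_of_real[symmetric]) simp

lemma L2_norm_eq_0:
  assumes "f \<in> L2T" "L2_norm f = 0" shows "AE z in circle_measure. f z = 0"
  using integral_nonneg_eq_0_iff_AE[OF L2T_integrable_sq[OF assms(1)]] assms(2)
  by (simp add: L2_norm_def)

lemma L2_norm_add_sq: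
  assumes "f \<in> L2T" "g \<in> L2T"
  shows "(L2_norm (\<lambda>z. f z + g z))\<^sup>2 = (L2_norm f)\<^sup>2 + (L2_norm g)\<^sup>2 + 2 * Re (L2_inner f g)"
proof -
  have "(L2_norm (\<lambda>z. f z + g z))\<^sup>2
      = (\<integral>z. (cmod (f z))\<^sup>2 + (cmod (g z))\<^sup>2 + 2 * Re (f z * cnj (g z)) \<partial>circle_measure)"
    unfolding L2_norm_sq by (simp add: cmod_add_sq del: times_complex.sel)
  also have "\<dots> = (L2_norm f)\<^sup>2 + (L2_norm g)\<^sup>2 + 2 * Re (L2_inner f g)"
    unfolding L2_norm_sq L2_inner_def
    using L2T_integrable_sq[OF assms(1)] L2T_integrable_sq[OF assms(2)] integrable_inner[OF assms]
    by (simp add: integral_Re del: times_complex.sel)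
  finally show ?thesis .
qed

lemma L2_norm_scale: "L2_norm (\<lambda>z. c * f z) = cmod c * L2_norm f"
  by (simp add: L2_norm_def norm_mult power_mult_distrib real_sqrt_mult)

lemma L2_norm_diff_sq:
  assumes "f \<in> L2T" "g \<in> L2T"
  shows "(L2_norm (\<lambda>z. f z - g z))\<^sup>2 = (L2_norm f)\<^sup>2 + (L2_norm g)\<^sup>2 - 2 * Re (L2_inner f g)"
  using L2_norm_add_sq[OF assms(1) L2T_scale[OF assms(2), of "-1"]] L2_norm_scale[of "-1" g]
    L2_inner_scale_right[of f "-1" g]
  by simp

lemma L2_Cauchy_Schwarz_abs:
  assumes "f \<in> L2T" "g \<in> L2T"
  shows "(\<integral>z. cmod (f z) * cmod (g z) \<partial>circle_measure) \<le> L2_norm f * L2_norm g"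
proof -
  define a b c where "a = (L2_norm f)\<^sup>2" and "b = (\<integral>z. cmod (f z) * cmod (g z) \<partial>circle_measure)"
    and "c = (L2_norm g)\<^sup>2"
  have quad: "0 \<le> a - 2 * t * b + t\<^sup>2 * c" for t
  proof -
    have "0 \<le> (\<integral>z. (cmod (f z) - t * cmod (g z))\<^sup>2 \<partial>circle_measure)"
      by simp
    also have "\<dots> = (\<integral>z. (cmod (f z))\<^sup>2 - 2 * t * (cmod (f z) * cmod (g z))
        + t\<^sup>2 * (cmod (g z))\<^sup>2 \<partial>circle_measure)"
      by (simp add: power2_diff power_mult_distrib algebra_simps)
    also have "\<dots> = a - 2 * t * b + t\<^sup>2 * c"
      unfolding a_def b_def c_def L2_norm_sq
      using L2T_integrable_sq[OF assms(1)] L2T_integrable_sq[OF assms(2)] integrable_cmod_mult[OF assms]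
      by simp
    finally show ?thesis .
  qed
  have "b\<^sup>2 \<le> a * c"
  proof (cases "c = 0")
    case True
    have "b = 0"
    proof (rule ccontr)
      assume "b \<noteq> 0"
      then show False
        using quad[of "(a + 1) / (2 * b)"] True by simp
    qed
    then show ?thesis
      by (simp add: a_def c_def)
  next
    case False
    then have "c > 0"
      by (simp add: c_def)
    then show ?thesis
      using quad[of "b / c"] by (simp add: field_simps power2_eq_square)
  qed
  then have "b\<^sup>2 \<le> (L2_norm f * L2_norm g)\<^sup>2"
    by (simp add: a_def c_def power_mult_distrib)
  then show ?thesis
    unfolding b_def by (rule power2_le_imp_le) simp
qed

lemma L2_Cauchy_Schwarz:
  assumes "f \<in> L2T" "g \<in> L2T"
  shows "cmod (L2_inner f g) \<le> L2_norm f * L2_norm g"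
proof -
  have "cmod (L2_inner f g) \<le> (\<integral>z. cmod (f z) * cmod (g z) \<partial>circle_measure)"
    unfolding L2_inner_def
    using integral_norm_bound[of circle_measure "\<lambda>z. f z * cnj (g z)"] by (simp add: norm_mult)
  also note L2_Cauchy_Schwarz_abs[OF assms]
  finally show ?thesis .
qed

lemma L2_norm_triangle:
  assumes "f \<in> L2T" "g \<in> L2T"
  shows "L2_norm (\<lambda>z. f z + g z) \<le> L2_norm f + L2_norm g"
proof (rule power2_le_imp_le)
  have "Re (L2_inner f g) \<le> L2_norm f * L2_norm g"
    using complex_Re_le_cmod L2_Cauchy_Schwarz[OF assms] by (rule order_trans)
  then show "(L2_norm (\<lambda>z. f z + g z))\<^sup>2 \<le> (L2_norm f + L2_norm g)\<^sup>2"
    unfolding L2_norm_add_sq[OF assms] by (simp add: power2_sum)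
qed simp

lemma L2_norm_cong_AE:
  assumes "AE z in circle_measure. f z = g z"
    "f \<in> borel_measurable circle_measure" "g \<in> borel_measurable circle_measure"
  shows "L2_norm f = L2_norm g"
  unfolding L2_norm_def
  by (intro arg_cong[where f = sqrt] integral_cong_AE) (use assms in auto)

section \<open>Completeness of \<open>L\<^sup>2\<close> and orthogonal projections\<close>

lemma nn_integral_cmod_sq:
  "f \<in> L2T \<Longrightarrow> (\<integral>\<^sup>+z. ennreal ((cmod (f z))\<^sup>2) \<partial>circle_measure) = ennreal ((L2_norm f)\<^sup>2)"
  by (simp add: nn_integral_eq_integral L2T_integrable_sq L2_norm_sq)

lemma L2_norm_one: "L2_norm (\<lambda>_. 1) = 1"
  by (simp add: L2_norm_def)

lemma L1_norm_le_L2_norm: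
  assumes "f \<in> L2T"
  shows "integrable circle_measure f" "(\<integral>z. cmod (f z) \<partial>circle_measure) \<le> L2_norm f"
proof -
  have one: "(\<lambda>_. 1) \<in> L2T"
    by (simp add: L2T_def)
  show "integrable circle_measure f"
    using integrable_mult_L2T[OF assms one] by simp
  show "(\<integral>z. cmod (f z) \<partial>circle_measure) \<le> L2_norm f"
    using L2_Cauchy_Schwarz_abs[OF assms one] L2_norm_one by simp
qed

text \<open>
  Along a subsequence whose consecutive distances are at most \<open>2\<^sup>-\<^sup>k\<close>, the increments have summable
  \<open>L\<^sup>1\<close> norms (the measure has mass one), so the subsequence converges almost everywhere.  Fatou's
  lemma then turns the Cauchy condition into convergence in norm to the pointwise limit.
\<close>
theorem Riesz_Fischer_circle:
  fixes F :: "nat \<Rightarrow> complex \<Rightarrow> complex"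
  assumes F: "\<And>n. F n \<in> L2T"
    and Cauchy: "\<And>e. e > 0 \<Longrightarrow> \<exists>N. \<forall>m\<ge>N. \<forall>n\<ge>N. L2_norm (\<lambda>z. F m z - F n z) \<le> e"
  obtains f where "f \<in> L2T" "(\<lambda>n. L2_norm (\<lambda>z. F n z - f z)) \<longlonglongrightarrow> 0"
proof -
  obtain N where N: "\<And>e m n. e > 0 \<Longrightarrow> m \<ge> N e \<Longrightarrow> n \<ge> N e \<Longrightarrow> L2_norm (\<lambda>z. F m z - F n z) \<le> e"
    using Cauchy by metis
  \<comment> \<open>Summing the thresholds makes the index sequence monotone.\<close>
  define r where "r k = (\<Sum>i\<le>k. N ((1/2) ^ i))" for k
  have r_mono: "r k \<le> r l" if "k \<le> l" for k l
    unfolding r_def using that by (intro sum_mono2) auto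
  have N_le_r: "N ((1/2) ^ k) \<le> r k" for k
    unfolding r_def by (rule member_le_sum) auto
  have r: "L2_norm (\<lambda>z. F m z - F n z) \<le> (1/2) ^ k" if "m \<ge> r k" "n \<ge> r k" for m n k
    using N[of "(1/2) ^ k" m n] N_le_r[of k] that by auto
  define G where "G k = F (r k)" for k
  have G: "G k \<in> L2T" for k
    by (simp add: G_def F)
  define d where "d k z = G (Suc k) z - G k z" for k z
  have d: "d k \<in> L2T" for k
    unfolding d_def by (intro L2T_diff G)
  have [measurable]: "F k \<in> borel_measurable circle_measure" "G k \<in> borel_measurable circle_measure"
    "d k \<in> borel_measurable circle_measure" for k
    using F[of k] G[of k] d[of k] by (auto simp: L2T_def)
  have d_bound: "(\<integral>\<^sup>+z. ennreal (cmod (d k z)) \<partial>circle_measure) \<le> ennreal ((1/2) ^ k)" for k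
  proof -
    have "(\<integral>\<^sup>+z. ennreal (cmod (d k z)) \<partial>circle_measure) = ennreal (\<integral>z. cmod (d k z) \<partial>circle_measure)"
      using L1_norm_le_L2_norm[OF d] by (intro nn_integral_eq_integral integrable_norm) auto
    also have "(\<integral>z. cmod (d k z) \<partial>circle_measure) \<le> L2_norm (d k)"
      by (rule L1_norm_le_L2_norm[OF d])
    also have "L2_norm (d k) \<le> (1/2) ^ k"
      unfolding d_def G_def by (rule r) (auto intro: r_mono)
    finally show ?thesis
      by (simp add: ennreal_leI)
  qed
  have "(\<integral>\<^sup>+z. (\<Sum>k. ennreal (cmod (d k z))) \<partial>circle_measure)
      = (\<Sum>k. \<integral>\<^sup>+z. ennreal (cmod (d k z)) \<partial>circle_measure)"
    by (rule nn_integral_suminf) measurable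
  also have "\<dots> \<le> (\<Sum>k. ennreal ((1/2) ^ k))"
    by (intro suminf_le d_bound) auto
  also have "\<dots> = ennreal (\<Sum>k. (1/2) ^ k)"
    by (intro suminf_ennreal2) (auto intro: summable_geometric)
  also have "\<dots> < \<infinity>"
    by simp
  finally have "AE z in circle_measure. (\<Sum>k. ennreal (cmod (d k z))) \<noteq> \<infinity>"
    by (intro nn_integral_noteq_infinite) auto
  then have conv: "AE z in circle_measure. convergent (\<lambda>k. G k z)"
  proof eventually_elim
    case (elim z)
    have "summable (\<lambda>k. cmod (d k z))"
      using elim by (intro summable_suminf_not_top) auto
    then have "summable (\<lambda>k. d k z)"
      by (rule summable_norm_cancel)
    then have "convergent (\<lambda>k. \<Sum>i<k. d i z)"
      by (simp add: summable_iff_convergent)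
    then have "convergent (\<lambda>k. (\<Sum>i<k. d i z) + G 0 z)"
      by (intro convergent_add convergent_const)
    then show ?case
      using sum_lessThan_telescope[of "\<lambda>k. G k z"] by (simp add: d_def)
  qed
  define f where "f z = lim (\<lambda>k. G k z)" for z
  have f_meas [measurable]: "f \<in> borel_measurable circle_measure"
    unfolding f_def by measurable
  have Fatou: "(\<integral>\<^sup>+z. ennreal ((cmod (F m z - f z))\<^sup>2) \<partial>circle_measure) \<le> ennreal (((1/2) ^ k)\<^sup>2)"
    if m: "m \<ge> r k" for m k
  proof -
    have "(\<integral>\<^sup>+z. ennreal ((cmod (F m z - f z))\<^sup>2) \<partial>circle_measure)
        = (\<integral>\<^sup>+z. liminf (\<lambda>j. ennreal ((cmod (F m z - G j z))\<^sup>2)) \<partial>circle_measure)"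
    proof (rule nn_integral_cong_AE)
      show "AE z in circle_measure. ennreal ((cmod (F m z - f z))\<^sup>2)
          = liminf (\<lambda>j. ennreal ((cmod (F m z - G j z))\<^sup>2))"
        using conv
      proof eventually_elim
        case (elim z)
        then have "(\<lambda>j. G j z) \<longlonglongrightarrow> f z"
          by (simp add: f_def convergent_LIMSEQ_iff)
        then have "(\<lambda>j. ennreal ((cmod (F m z - G j z))\<^sup>2)) \<longlonglongrightarrow> ennreal ((cmod (F m z - f z))\<^sup>2)"
          by (intro tendsto_intros)
        then show ?case
          by (intro lim_imp_Liminf[symmetric]) auto
      qed
    qed
    also have "\<dots> \<le> liminf (\<lambda>j. \<integral>\<^sup>+z. ennreal ((cmod (F m z - G j z))\<^sup>2) \<partial>circle_measure)"
      by (rule nn_integral_liminf) measurable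
    also have "\<dots> \<le> liminf (\<lambda>j. ennreal (((1/2) ^ k)\<^sup>2))"
    proof (rule Liminf_mono)
      show "\<forall>\<^sub>F j in sequentially. (\<integral>\<^sup>+z. ennreal ((cmod (F m z - G j z))\<^sup>2) \<partial>circle_measure)
          \<le> ennreal (((1/2) ^ k)\<^sup>2)"
        using eventually_ge_at_top[of k]
      proof eventually_elim
        case (elim j)
        have "L2_norm (\<lambda>z. F m z - G j z) \<le> (1/2) ^ k"
          unfolding G_def using m r_mono[OF elim] by (intro r)
        then show ?case
          by (subst nn_integral_cmod_sq) (auto intro!: L2T_diff F G ennreal_leI power_mono)
      qed
    qed
    also have "\<dots> = ennreal (((1/2) ^ k)\<^sup>2)"
      by (simp add: Liminf_const)
    finally show ?thesis .
  qed
  have diff: "(\<lambda>z. F m z - f z) \<in> L2T" if "m \<ge> r k" for m k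
  proof -
    have "integrable circle_measure (\<lambda>z. (cmod (F m z - f z))\<^sup>2)"
      by (rule integrableI_bounded) (use le_less_trans[OF Fatou[OF that]] in auto)
    then show ?thesis
      by (simp add: L2T_def)
  qed
  show ?thesis
  proof
    show "f \<in> L2T"
      using L2T_diff[OF F[of "r 0"] diff[of 0 "r 0"]] by simp
    show "(\<lambda>n. L2_norm (\<lambda>z. F n z - f z)) \<longlonglongrightarrow> 0"
    proof (rule LIMSEQ_I)
      fix e :: real assume "e > 0"
      then obtain k where k: "(1/2) ^ k < e"
        using real_arch_pow_inv[of e "1/2"] by auto
      have "L2_norm (\<lambda>z. F m z - f z) < e" if "m \<ge> r k" for m
      proof -
        have "ennreal ((L2_norm (\<lambda>z. F m z - f z))\<^sup>2) \<le> ennreal (((1/2) ^ k)\<^sup>2)"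
          using Fatou[OF that] nn_integral_cmod_sq[OF diff[OF that]] by simp
        then have "L2_norm (\<lambda>z. F m z - f z) \<le> (1/2) ^ k"
          by (subst (asm) ennreal_le_iff) (auto intro: power2_le_imp_le)
        with k show ?thesis
          by simp
      qed
      then show "\<exists>no. \<forall>n\<ge>no. norm (L2_norm (\<lambda>z. F n z - f z) - 0) < e"
        by auto
    qed
  qed
qed

lemma closed_subspace_L2D:
  assumes "closed_subspace_L2 N"
  shows "f \<in> N \<Longrightarrow> f \<in> L2T" "(\<lambda>_. 0) \<in> N"
    "f \<in> N \<Longrightarrow> g \<in> N \<Longrightarrow> (\<lambda>z. f z + g z) \<in> N" "f \<in> N \<Longrightarrow> (\<lambda>z. c * f z) \<in> N"
    "(\<And>n. F n \<in> N) \<Longrightarrow> f \<in> L2T \<Longrightarrow> (\<lambda>n. L2_norm (\<lambda>z. F n z - f z)) \<longlonglongrightarrow> 0 \<Longrightarrow> f \<in> N"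
  using assms unfolding closed_subspace_L2_def by blast+

lemma closed_subspace_diff:
  assumes "closed_subspace_L2 N" "f \<in> N" "g \<in> N"
  shows "(\<lambda>z. f z - g z) \<in> N"
  using closed_subspace_L2D(3)[OF assms(1,2) closed_subspace_L2D(4)[OF assms(1,3), of "-1"]] by simp

lemma closed_subspace_AE:
  assumes "closed_subspace_L2 N" "f \<in> N" "g \<in> borel_measurable circle_measure"
    and "AE z in circle_measure. g z = f z"
  shows "g \<in> N"
proof (rule closed_subspace_L2D(5)[OF assms(1)])
  have f: "f \<in> L2T"
    by (rule closed_subspace_L2D(1)[OF assms(1,2)])
  have "integrable circle_measure (\<lambda>z. (cmod (g z))\<^sup>2)"
    using L2T_integrable_sq[OF f]
    by (rule integrable_cong_AE_imp) (use assms in auto)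
  with assms show "g \<in> L2T"
    by (simp add: L2T_def)
  have "L2_norm (\<lambda>z. f z - g z) = L2_norm (\<lambda>_. 0)"
    using assms f by (intro L2_norm_cong_AE) (auto simp: L2T_def)
  then show "(\<lambda>n. L2_norm (\<lambda>z. f z - g z)) \<longlonglongrightarrow> 0"
    by (simp add: L2_norm_def)
qed fact

text \<open>
  A minimizing sequence for the distance from \<open>f\<close> to \<open>N\<close> is Cauchy by the parallelogram law.  Its limit
  \<open>p\<close> attains the distance, and comparing \<open>p\<close> with \<open>p + c g\<close> for a small multiple \<open>c\<close> of the inner
  product of \<open>f - p\<close> with \<open>g\<close> forces this inner product to vanish.
\<close>
lemma orthogonal_decomposition:
  assumes N: "closed_subspace_L2 N" and f: "f \<in> L2T"
  obtains p where "p \<in> N" "\<And>g. g \<in> N \<Longrightarrow> L2_inner (\<lambda>z. f z - p z) g = 0"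
proof -
  note ND = closed_subspace_L2D[OF N]
  define D where "D g = (L2_norm (\<lambda>z. f z - g z))\<^sup>2" for g
  define \<delta> where "\<delta> = (INF g\<in>N. D g)"
  have bdd: "bdd_below (D ` N)"
    by (rule bdd_belowI2[of _ 0]) (simp add: D_def)
  have \<delta>_le: "\<delta> \<le> D g" if "g \<in> N" for g
    unfolding \<delta>_def by (rule cINF_lower[OF bdd that])
  have "\<exists>g\<in>N. D g < \<delta> + e" if "e > 0" for e
    using cINF_less_iff[OF _ bdd, of "\<delta> + e"] ND(2) that unfolding \<delta>_def by auto
  then have "\<exists>g\<in>N. D g < \<delta> + 1 / real (Suc n)" for n
    by simp
  then obtain G where G: "\<And>n. G n \<in> N" "\<And>n. D (G n) < \<delta> + 1 / real (Suc n)"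
    by metis
  have GL: "G n \<in> L2T" for n
    using G ND by blast
  have near: "(L2_norm (\<lambda>z. G m z - G n z))\<^sup>2 \<le> 2 * (1 / real (Suc m) + 1 / real (Suc n))" for m n
  proof -
    let ?a = "\<lambda>z. f z - G m z" and ?b = "\<lambda>z. f z - G n z"
    have L: "?a \<in> L2T" "?b \<in> L2T"
      by (intro L2T_diff f GL)+
    have "(\<lambda>z. (1/2) * (G m z + G n z)) \<in> N"
      by (intro ND(3,4) G)
    note mid = \<delta>_le[OF this]
    have "(\<lambda>z. ?a z + ?b z) = (\<lambda>z. 2 * (f z - (1/2) * (G m z + G n z)))"
      by (auto simp: algebra_simps)
    then have "(L2_norm (\<lambda>z. ?a z + ?b z))\<^sup>2 = 4 * D (\<lambda>z. (1/2) * (G m z + G n z))"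
      using L2_norm_scale[of 2 "\<lambda>z. f z - (1/2) * (G m z + G n z)"]
      by (simp only: D_def power_mult_distrib) simp
    moreover have "(\<lambda>z. ?b z - ?a z) = (\<lambda>z. G m z - G n z)"
      by (auto simp: algebra_simps)
    ultimately have "(L2_norm (\<lambda>z. G m z - G n z))\<^sup>2
        = 2 * D (G m) + 2 * D (G n) - 4 * D (\<lambda>z. (1/2) * (G m z + G n z))"
      using L2_norm_add_sq[OF L] L2_norm_diff_sq[OF L(2,1)] L2_inner_commute[of ?b ?a]
      unfolding D_def by simp
    with mid G(2)[of m] G(2)[of n] show ?thesis
      by simp
  qed
  have "\<exists>K. \<forall>m\<ge>K. \<forall>n\<ge>K. L2_norm (\<lambda>z. G m z - G n z) \<le> e" if "e > 0" for e
  proof -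
    obtain K where K: "inverse (real (Suc K)) < e\<^sup>2 / 4"
      using reals_Archimedean[of "e\<^sup>2 / 4"] \<open>e > 0\<close> by auto
    have "L2_norm (\<lambda>z. G m z - G n z) \<le> e" if mn: "m \<ge> K" "n \<ge> K" for m n
    proof (rule power2_le_imp_le)
      have "1 / real (Suc m) \<le> 1 / real (Suc K)" "1 / real (Suc n) \<le> 1 / real (Suc K)"
        using mn by (auto intro!: divide_left_mono)
      then show "(L2_norm (\<lambda>z. G m z - G n z))\<^sup>2 \<le> e\<^sup>2"
        using near[of m n] K by (simp add: inverse_eq_divide)
    qed (use \<open>e > 0\<close> in simp)
    then show ?thesis
      by blast
  qed
  from Riesz_Fischer_circle[OF GL this] obtain p
    where p: "p \<in> L2T" "(\<lambda>n. L2_norm (\<lambda>z. G n z - p z)) \<longlonglongrightarrow> 0"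
    by blast
  have pN: "p \<in> N"
    by (rule ND(5)[OF G(1) p])
  have min: "D p \<le> \<delta>"
  proof -
    have 1: "L2_norm (\<lambda>z. f z - p z) \<le> sqrt (\<delta> + 1 / real (Suc n)) + L2_norm (\<lambda>z. G n z - p z)" for n
    proof -
      have "L2_norm (\<lambda>z. f z - p z) = L2_norm (\<lambda>z. (f z - G n z) + (G n z - p z))"
        by simp
      also have "\<dots> \<le> L2_norm (\<lambda>z. f z - G n z) + L2_norm (\<lambda>z. G n z - p z)"
        by (intro L2_norm_triangle L2T_diff f GL p)
      also have "L2_norm (\<lambda>z. f z - G n z) \<le> sqrt (\<delta> + 1 / real (Suc n))"
        using G(2)[of n] unfolding D_def by (intro real_le_rsqrt) simp
      finally show ?thesis
        by simp
    qed
    have "(\<lambda>n. 1 / real (Suc n)) \<longlonglongrightarrow> 0"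
      using LIMSEQ_inverse_real_of_nat by (simp add: inverse_eq_divide)
    then have "(\<lambda>n. sqrt (\<delta> + 1 / real (Suc n)) + L2_norm (\<lambda>z. G n z - p z)) \<longlonglongrightarrow> sqrt (\<delta> + 0) + 0"
      using p(2) by (intro tendsto_intros)
    then have "L2_norm (\<lambda>z. f z - p z) \<le> sqrt (\<delta> + 0) + 0"
      by (rule LIMSEQ_le_const) (use 1 in auto)
    moreover have "0 \<le> \<delta>"
      unfolding \<delta>_def using ND(2) by (intro cINF_greatest) (auto simp: D_def)
    ultimately show ?thesis
      unfolding D_def using power_mono[of "L2_norm (\<lambda>z. f z - p z)" "sqrt \<delta>" 2] by simp
  qed
  show ?thesis
  proof
    show "p \<in> N" by fact
    fix g assume g: "g \<in> N"
    define a where "a = L2_inner (\<lambda>z. f z - p z) g"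
    \<comment> \<open>Any positive \<open>t\<close> with \<open>t \<parallel>g\<parallel>\<^sup>2 < 2\<close> would do; the \<open>+ 1\<close> covers the case \<open>\<parallel>g\<parallel> = 0\<close>.\<close>
    define t where "t = 1 / ((L2_norm g)\<^sup>2 + 1)"
    have t: "t > 0" "t * (L2_norm g)\<^sup>2 \<le> 1"
      using add_nonneg_pos[of "(L2_norm g)\<^sup>2" 1] unfolding t_def by simp_all
    let ?c = "complex_of_real t * a"
    have L: "(\<lambda>z. f z - p z) \<in> L2T" "(\<lambda>z. ?c * g z) \<in> L2T"
      using g ND(1) by (intro L2T_diff L2T_scale f p; blast)+
    have "(\<lambda>z. p z + ?c * g z) \<in> N"
      by (intro ND(3,4) pN g)
    then have "D p \<le> D (\<lambda>z. p z + ?c * g z)"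
      using min \<delta>_le by (meson order_trans)
    also have "D (\<lambda>z. p z + ?c * g z) = (L2_norm (\<lambda>z. (f z - p z) - ?c * g z))\<^sup>2"
      by (simp add: D_def algebra_simps)
    also have "\<dots> = D p + t\<^sup>2 * (cmod a)\<^sup>2 * (L2_norm g)\<^sup>2 - 2 * t * (cmod a)\<^sup>2"
    proof -
      have "Re (cnj ?c * a) = t * (cmod a)\<^sup>2"
        unfolding cmod_power2 by (simp add: power2_eq_square algebra_simps)
      then show ?thesis
        unfolding L2_norm_diff_sq[OF L] L2_norm_scale L2_inner_scale_right D_def
        by (simp add: norm_mult power_mult_distrib a_def[symmetric])
    qed
    finally have "2 * t * (cmod a)\<^sup>2 \<le> t * (cmod a)\<^sup>2 * (t * (L2_norm g)\<^sup>2)"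
      by (simp add: power2_eq_square algebra_simps)
    also have "\<dots> \<le> t * (cmod a)\<^sup>2 * 1"
      using t by (intro mult_left_mono) auto
    finally have "t * (cmod a)\<^sup>2 \<le> 0"
      by simp
    with t show "L2_inner (\<lambda>z. f z - p z) g = 0"
      by (simp add: a_def mult_le_0_iff)
  qed
qed

section \<open>Uniqueness of Fourier coefficients\<close>

lemma fourier_coeff_eq: "fourier_coeff f n = (\<integral>z. z powi (-n) * f z \<partial>circle_measure)"
  unfolding fourier_coeff_def L2_inner_def
  by (rule Bochner_Integration.integral_cong) (simp_all add: cnj_powi_circle mult.commute del: complex_cnj_power_int)

lemma integrable_mult_Linf:
  assumes "integrable circle_measure F" "\<phi> \<in> LinfT"
  shows "integrable circle_measure (\<lambda>z. \<phi> z * F z)"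
proof -
  obtain C where C: "AE z in circle_measure. cmod (\<phi> z) \<le> C"
    using assms by (auto simp: LinfT_def)
  show ?thesis
  proof (rule Bochner_Integration.integrable_bound)
    show "integrable circle_measure (\<lambda>z. C * cmod (F z))"
      using assms by (intro integrable_mult_right integrable_norm)
    show "AE z in circle_measure. norm (\<phi> z * F z) \<le> norm (C * cmod (F z))"
      using C by eventually_elim (auto simp: norm_mult abs_mult intro!: mult_right_mono)
  qed (use assms in measurable)
qed

lemma LinfT_continuous:
  assumes "continuous_on (sphere 0 1) f"
  shows "f \<in> LinfT"
proof -
  have "compact (f ` sphere 0 1)"
    by (intro compact_continuous_image assms) auto
  then obtain C where "\<forall>w\<in>f ` sphere 0 1. cmod w \<le> C"
    using compact_imp_bounded bounded_iff by blast
  then show ?thesis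
    using borel_measurable_circle_continuous[OF assms] AE_circle
    by (auto simp: LinfT_def intro!: exI[of _ C])
qed

text \<open>
  The functions with vanishing Fourier coefficients are stable under multiplication by \<open>z\<close> and
  \<open>1/z\<close>, and on the circle a real linear form is a combination of these two.  Quantifying over \<open>F\<close>
  in the induction reduces a product \<open>p q F\<close> to \<open>p (q F)\<close>.
\<close>
lemma fourier_coeff_zero_mult_polynomial:
  assumes "real_polynomial_function p" "integrable circle_measure F" "\<And>n. fourier_coeff F n = 0"
  shows "fourier_coeff (\<lambda>z. complex_of_real (p z) * F z) n = 0"
  using assms
proof (induction arbitrary: F n rule: real_polynomial_function.induct)
  case (linear p F n)
  note F = linear.prems
  interpret bounded_linear p by fact
  define a where "a = (complex_of_real (p 1) - \<i> * complex_of_real (p \<i>)) / 2"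
  have p: "complex_of_real (p z) = a * z + cnj a * inverse z" if "cmod z = 1" for z
  proof -
    have "z = Re z *\<^sub>R 1 + Im z *\<^sub>R \<i>"
      by (simp add: complex_eq_iff)
    then have "p z = p (Re z *\<^sub>R 1 + Im z *\<^sub>R \<i>)"
      by (rule arg_cong)
    also have "\<dots> = Re z * p 1 + Im z * p \<i>"
      by (simp only: add scaleR real_scaleR_def)
    finally show ?thesis
      unfolding cnj_circle[OF that, symmetric] by (simp add: a_def complex_eq_iff field_simps)
  qed
  have int: "integrable circle_measure (\<lambda>z. z powi k * F z)" for k
    by (intro integrable_mult_Linf LinfT_powi F)
  have "fourier_coeff (\<lambda>z. complex_of_real (p z) * F z) n
      = (\<integral>z. a * (z powi (-(n - 1)) * F z) + cnj a * (z powi (-(n + 1)) * F z) \<partial>circle_measure)"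
    unfolding fourier_coeff_eq
  proof (rule Bochner_Integration.integral_cong)
    fix z assume "z \<in> space circle_measure"
    then have z: "cmod z = 1" by simp
    then have "z \<noteq> 0" by auto
    then have "z powi (-(n - 1)) = z powi (-n) * z" "z powi (-(n + 1)) = z powi (-n) * inverse z"
      using power_int_add[of z "-n" 1] power_int_add[of z "-n" "-1"]
      by (simp_all add: power_int_minus)
    then show "z powi - n * (complex_of_real (p z) * F z)
        = a * (z powi (-(n - 1)) * F z) + cnj a * (z powi (-(n + 1)) * F z)"
      by (simp add: p[OF z] algebra_simps)
  qed simp
  also have "\<dots> = a * fourier_coeff F (n - 1) + cnj a * fourier_coeff F (n + 1)"
    unfolding fourier_coeff_eq using int[of "- (n-1)"] int[of "-(n+1)"] by simp
  finally show ?case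
    using F by simp
next
  case (const c F n)
  then show ?case
    by (simp add: fourier_coeff_eq mult.left_commute[of _ "complex_of_real c"])
next
  case (add p q F n)
  have "integrable circle_measure (\<lambda>z. complex_of_real (r z) * F z)"
    if "real_polynomial_function r" for r
    by (intro integrable_mult_Linf LinfT_continuous add continuous_intros
        continuous_on_polymonial_function) (use that in \<open>simp add: real_polynomial_function_eq\<close>)
  then have "integrable circle_measure (\<lambda>z. z powi (-n) * (complex_of_real (p z) * F z))"
    "integrable circle_measure (\<lambda>z. z powi (-n) * (complex_of_real (q z) * F z))"
    using add.hyps by (auto intro: integrable_mult_Linf LinfT_powi)
  then have "fourier_coeff (\<lambda>z. complex_of_real (p z + q z) * F z) n
      = fourier_coeff (\<lambda>z. complex_of_real (p z) * F z) n + fourier_coeff (\<lambda>z. complex_of_real (q z) * F z) n"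
    unfolding fourier_coeff_eq by (simp add: distrib_left distrib_right)
  then show ?case
    using add.IH add.prems by simp
next
  case (mult p q F n)
  have "integrable circle_measure (\<lambda>z. complex_of_real (q z) * F z)"
    by (intro integrable_mult_Linf LinfT_continuous mult continuous_intros
        continuous_on_polymonial_function) (use mult in \<open>simp add: real_polynomial_function_eq\<close>)
  from mult.IH(1)[OF this mult.IH(2)[OF mult.prems]] show ?case
    by (simp add: mult.assoc)
qed

text \<open>
  Stone--Weierstrass approximates \<open>k\<close> uniformly on the circle by polynomials in the two real
  coordinates, and uniform approximation suffices because \<open>F\<close> is integrable.
\<close>
lemma integral_mult_continuous_eq_zero:
  assumes k: "continuous_on UNIV (k :: complex \<Rightarrow> real)"
    and F: "integrable circle_measure F" "\<And>n. fourier_coeff F n = 0"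
  shows "(\<integral>z. k z *\<^sub>R F z \<partial>circle_measure) = 0"
proof -
  have intc: "integrable circle_measure (\<lambda>z. complex_of_real (r z) * F z)"
    if "continuous_on UNIV r" for r
    using that by (intro integrable_mult_Linf LinfT_continuous F continuous_intros) (auto intro: continuous_on_subset)
  define I where "I = (\<integral>z. cmod (F z) \<partial>circle_measure)"
  have I: "0 \<le> I"
    by (simp add: I_def)
  have bound: "cmod (\<integral>z. k z *\<^sub>R F z \<partial>circle_measure) \<le> e * I" if e: "e > 0" for e
  proof -
    have "continuous_on (sphere 0 1) k"
      using k by (rule continuous_on_subset) simp
    from Stone_Weierstrass_real_polynomial_function[OF compact_sphere this e]
    obtain p where p: "real_polynomial_function p" "\<And>z. z \<in> sphere 0 1 \<Longrightarrow> \<bar>k z - p z\<bar> < e"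
      by blast
    have pc: "continuous_on UNIV p"
      using p(1) by (intro continuous_on_polymonial_function) (simp add: real_polynomial_function_eq)
    have "(\<integral>z. complex_of_real (p z) * F z \<partial>circle_measure) = 0"
      using fourier_coeff_zero_mult_polynomial[OF p(1) F, of 0] by (simp add: fourier_coeff_eq)
    then have "(\<integral>z. k z *\<^sub>R F z \<partial>circle_measure)
        = (\<integral>z. complex_of_real (k z - p z) * F z \<partial>circle_measure)"
      using intc[OF k] intc[OF pc] by (simp add: scaleR_conv_of_real left_diff_distrib)
    also have "cmod \<dots> \<le> (\<integral>z. cmod (complex_of_real (k z - p z) * F z) \<partial>circle_measure)"
      by (rule integral_norm_bound)
    also have "\<dots> \<le> (\<integral>z. e * cmod (F z) \<partial>circle_measure)"
    proof (rule integral_mono)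
      show "integrable circle_measure (\<lambda>z. cmod (complex_of_real (k z - p z) * F z))"
        by (intro integrable_norm intc continuous_intros k pc)
      show "integrable circle_measure (\<lambda>z. e * cmod (F z))"
        by (intro integrable_mult_right integrable_norm F)
      show "cmod (complex_of_real (k z - p z) * F z) \<le> e * cmod (F z)"
        if "z \<in> space circle_measure" for z
        unfolding norm_mult using p(2)[of z] that by (intro mult_right_mono) (auto simp flip: of_real_diff)
    qed
    also have "\<dots> = e * I"
      by (simp add: I_def)
    finally show ?thesis .
  qed
  have "cmod (\<integral>z. k z *\<^sub>R F z \<partial>circle_measure) \<le> 0"
  proof (rule field_le_epsilon)
    fix e :: real assume "e > 0"
    then have "cmod (\<integral>z. k z *\<^sub>R F z \<partial>circle_measure) \<le> e / (I + 1) * I"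
      using I by (intro bound) auto
    also have "\<dots> \<le> e"
      using I \<open>e > 0\<close> by (simp add: field_simps)
    finally show "cmod (\<integral>z. k z *\<^sub>R F z \<partial>circle_measure) \<le> 0 + e"
      by simp
  qed
  then show ?thesis
    by simp
qed

text \<open>
  The indicator function of a closed set is the decreasing limit of the continuous functions
  \<open>max 0 (1 - n d(z, C))\<close>.  The empty set is separate because \<open>infdist\<close> to it is zero.
\<close>
lemma integral_closed_set_eq_zero:
  assumes C: "closed C"
    and F: "integrable circle_measure F" "\<And>n. fourier_coeff F n = 0"
  shows "(\<integral>z. indicat_real C z *\<^sub>R F z \<partial>circle_measure) = 0"
proof (cases "C = {}")
  case False
  have [measurable]: "C \<in> sets borel" using C by simp
  define k where "k n z = max 0 (1 - real n * infdist z C)" for n and z :: complex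
  have k: "continuous_on UNIV (k n)" for n
    unfolding k_def by (intro continuous_intros)
  have "(\<lambda>n. \<integral>z. k n z *\<^sub>R F z \<partial>circle_measure)
      \<longlonglongrightarrow> (\<integral>z. indicat_real C z *\<^sub>R F z \<partial>circle_measure)"
  proof (rule integral_dominated_convergence[where w = "\<lambda>z. cmod (F z)"])
    have [measurable]: "indicat_real C \<in> borel_measurable circle_measure"
      by (rule measurable_compose[OF borel_measurable_circle_id]) measurable
    show "(\<lambda>z. indicat_real C z *\<^sub>R F z) \<in> borel_measurable circle_measure"
      using F by measurable
    show "(\<lambda>z. k n z *\<^sub>R F z) \<in> borel_measurable circle_measure" for n
      using F borel_measurable_circle_continuous[OF continuous_on_subset[OF k]] by measurable
    show "integrable circle_measure (\<lambda>z. cmod (F z))"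
      using F by simp
    show "AE z in circle_measure. (\<lambda>n. k n z *\<^sub>R F z) \<longlonglongrightarrow> indicat_real C z *\<^sub>R F z"
    proof (intro AE_I2 tendsto_scaleR tendsto_const)
      fix z
      show "(\<lambda>n. k n z) \<longlonglongrightarrow> indicat_real C z"
      proof (cases "z \<in> C")
        case True
        then show ?thesis by (simp add: k_def)
      next
        case z: False
        then have pos: "infdist z C > 0"
          using C False by (simp add: infdist_pos_not_in_closed)
        obtain m where m: "1 < real m * infdist z C"
          using reals_Archimedean3[OF pos] by blast
        have "k n z = 0" if "n \<ge> m" for n
        proof -
          have "real m * infdist z C \<le> real n * infdist z C"
            using pos that by simp
          with m show ?thesis by (simp add: k_def)
        qed
        then show ?thesis
          using z by (intro tendsto_eventually) (auto simp: eventually_sequentially)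
      qed
    qed
    show "AE z in circle_measure. norm (k n z *\<^sub>R F z) \<le> cmod (F z)" for n
      by (auto simp: k_def infdist_nonneg intro!: mult_left_le_one_le)
  qed
  moreover have "(\<lambda>n. \<integral>z. k n z *\<^sub>R F z \<partial>circle_measure) = (\<lambda>_. 0)"
    using integral_mult_continuous_eq_zero[OF k F] by simp
  ultimately show ?thesis
    using LIMSEQ_unique tendsto_const by metis
qed simp

text \<open>
  The complex measure with density \<open>F\<close> vanishes on closed sets, hence on all Borel sets by the
  \<open>\<pi>\<close>-\<open>\<lambda>\<close> theorem, and then its density vanishes almost everywhere.  The statement is about \<open>L\<^sup>1\<close>
  because it is applied below to squared moduli of functions in \<open>L\<^sup>2\<close>.
\<close>
theorem fourier_uniqueness:
  assumes F: "integrable circle_measure F" "\<And>n. fourier_coeff F n = 0"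
  shows "AE z in circle_measure. F z = 0"
proof -
  have sets: "sphere 0 1 \<inter> A \<in> sets circle_measure" if "A \<in> sets borel" for A
    using that by (auto simp: sets_circle_measure sets_restrict_space)
  have zero: "(LINT z:sphere 0 1 \<inter> A|circle_measure. F z) = 0" if "A \<in> sets borel" for A
  proof -
    have "Int_stable (Collect closed :: complex set set)"
      by (auto simp: Int_stable_def)
    moreover have "Collect closed \<subseteq> Pow (UNIV :: complex set)"
      by simp
    moreover have borel: "sigma_sets UNIV (Collect closed) = sets (borel :: complex measure)"
      by (simp add: borel_eq_closed)
    then have "A \<in> sigma_sets UNIV (Collect closed)"
      using that by simp
    ultimately show ?thesis
    proof (induction rule: sigma_sets_induct_disjoint)
      case (basic A)
      then have "(\<integral>z. indicat_real A z *\<^sub>R F z \<partial>circle_measure) = 0"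
        using integral_closed_set_eq_zero F by simp
      moreover have "(LINT z:sphere 0 1 \<inter> A|circle_measure. F z) = (\<integral>z. indicat_real A z *\<^sub>R F z \<partial>circle_measure)"
        unfolding set_lebesgue_integral_def
        by (rule Bochner_Integration.integral_cong) (auto simp: indicator_def)
      ultimately show ?case
        by simp
    next
      case empty
      then show ?case
        by (simp add: set_lebesgue_integral_def)
    next
      case (compl A)
      have "(LINT z:sphere 0 1 \<inter> (UNIV - A)|circle_measure. F z)
          = (\<integral>z. F z - indicat_real (sphere 0 1 \<inter> A) z *\<^sub>R F z \<partial>circle_measure)"
        unfolding set_lebesgue_integral_def
        by (rule Bochner_Integration.integral_cong) (auto simp: indicator_def)
      also have "\<dots> = (\<integral>z. F z \<partial>circle_measure) - (LINT z:sphere 0 1 \<inter> A|circle_measure. F z)"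
        unfolding set_lebesgue_integral_def
        using compl borel by (intro Bochner_Integration.integral_diff F integrable_mult_indicator sets) auto
      finally show ?case
        using compl F(2)[of 0] by (simp add: fourier_coeff_eq)
    next
      case (union A)
      have "(LINT z:(\<Union>i. sphere 0 1 \<inter> A i)|circle_measure. F z)
          = (\<Sum>i. LINT z:sphere 0 1 \<inter> A i|circle_measure. F z)"
      proof (rule lebesgue_integral_countable_add)
        show "sphere 0 1 \<inter> A i \<in> sets circle_measure" for i
          using union borel by (intro sets) auto
        then have "(\<Union>i. sphere 0 1 \<inter> A i) \<in> sets circle_measure"
          by blast
        then show "set_integrable circle_measure (\<Union>i. sphere 0 1 \<inter> A i) F"
          unfolding set_integrable_def by (intro integrable_mult_indicator F)
      qed (use union in \<open>auto simp: disjoint_family_on_def\<close>)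
      then show ?case
        using union by simp
    qed
  qed
  show ?thesis
  proof (rule circle.density_unique_banach[of F "\<lambda>_. 0"])
    fix A assume "A \<in> sets circle_measure"
    then obtain B where "B \<in> sets borel" "A = sphere 0 1 \<inter> B"
      by (auto simp: sets_circle_measure sets_restrict_space)
    then show "(LINT z:A|circle_measure. F z) = (LINT z:A|circle_measure. 0)"
      using zero by (simp add: set_lebesgue_integral_def)
  qed (use F in auto)
qed

lemma closed_subspace_orth_in:
  assumes A: "A \<subseteq> L2T"
  shows "closed_subspace_L2 (orth_in L2T A)"
  unfolding closed_subspace_L2_def
proof (intro conjI ballI allI impI)
  show "orth_in L2T A \<subseteq> L2T"
    by (auto simp: orth_in_def)
  show "(\<lambda>_. 0) \<in> orth_in L2T A"
    by (simp add: orth_in_def L2T_def L2_inner_def)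
  show "(\<lambda>z. f z + g z) \<in> orth_in L2T A" if "f \<in> orth_in L2T A" "g \<in> orth_in L2T A" for f g
    using that A by (auto simp: orth_in_def L2T_add L2_inner_add_left subset_iff)
  show "(\<lambda>z. c * f z) \<in> orth_in L2T A" if "f \<in> orth_in L2T A" for f c
    using that by (auto simp: orth_in_def L2T_scale L2_inner_scale_left)
  fix F :: "nat \<Rightarrow> complex \<Rightarrow> complex" and f
  assume f: "f \<in> L2T"
    and F: "(\<forall>n. F n \<in> orth_in L2T A) \<and> (\<lambda>n. L2_norm (\<lambda>z. F n z - f z)) \<longlonglongrightarrow> 0"
  have FL: "F n \<in> L2T" and Fa: "a \<in> A \<Longrightarrow> L2_inner (F n) a = 0" for n a
    using F by (auto simp: orth_in_def)
  have "L2_inner f a = 0" if a: "a \<in> A" for a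
  proof -
    have aL: "a \<in> L2T" using a A by blast
    have "cmod (L2_inner f a) \<le> L2_norm (\<lambda>z. F n z - f z) * L2_norm a" for n
      using L2_Cauchy_Schwarz[OF L2T_diff[OF FL[of n] f] aL] Fa[OF a, of n]
      by (simp add: L2_inner_diff_left FL f aL)
    moreover have "(\<lambda>n. L2_norm (\<lambda>z. F n z - f z) * L2_norm a) \<longlonglongrightarrow> 0 * L2_norm a"
      using F by (intro tendsto_intros) auto
    ultimately have "cmod (L2_inner f a) \<le> 0 * L2_norm a"
      by (intro LIMSEQ_le_const[of _ "0 * L2_norm a"]) auto
    then show ?thesis by simp
  qed
  with f show "f \<in> orth_in L2T A"
    by (simp add: orth_in_def)
qed

lemma fourier_uniqueness_L2:
  assumes "f \<in> L2T" "\<And>n. fourier_coeff f n = 0"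
  shows "AE z in circle_measure. f z = 0"
  using fourier_uniqueness[OF L1_norm_le_L2_norm(1)] assms by blast

lemma L2T_powi: "(\<lambda>z. z powi n) \<in> L2T"
  by (intro LinfT_subset_L2T LinfT_powi)

lemma L2T_shift: "f \<in> L2T \<Longrightarrow> (\<lambda>z. z powi n * f z) \<in> L2T"
  by (intro L2T_mult_Linf LinfT_powi)

text \<open>
  The component of \<open>f\<close> orthogonal to \<open>N\<close> has vanishing Fourier coefficients.
\<close>
lemma trigonometric_polynomials_dense:
  assumes N: "closed_subspace_L2 N" and powi: "\<And>n. (\<lambda>z. z powi n) \<in> N" and f: "f \<in> L2T"
  shows "f \<in> N"
proof -
  obtain p where p: "p \<in> N" "\<And>g. g \<in> N \<Longrightarrow> L2_inner (\<lambda>z. f z - p z) g = 0"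
    using orthogonal_decomposition[OF N f] by blast
  have "(\<lambda>z. f z - p z) \<in> L2T"
    by (intro L2T_diff f closed_subspace_L2D(1)[OF N p(1)])
  then have "AE z in circle_measure. f z - p z = 0"
    by (rule fourier_uniqueness_L2) (simp add: fourier_coeff_def p(2) powi)
  then show ?thesis
    using f by (intro closed_subspace_AE[OF N p(1)]) (auto simp: L2T_def)
qed

section \<open>The Hardy space\<close>

lemma H2_eq_orth_in: "H2 = orth_in L2T {\<lambda>z. z powi n |n. n < 0}"
  by (auto simp: H2_def orth_in_def fourier_coeff_def)

lemma H2D: "f \<in> H2 \<Longrightarrow> f \<in> L2T" "f \<in> H2 \<Longrightarrow> n < 0 \<Longrightarrow> fourier_coeff f n = 0"
  by (auto simp: H2_def)

lemma fourier_coeff_shift: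
  "fourier_coeff (\<lambda>z. z powi k * f z) n = fourier_coeff f (n - k)"
  unfolding fourier_coeff_eq
proof (rule Bochner_Integration.integral_cong)
  fix z :: complex assume "z \<in> space circle_measure"
  then have "z \<noteq> 0" by auto
  then show "z powi - n * (z powi k * f z) = z powi - (n - k) * f z"
    using power_int_add[of z "-n" k] by (simp add: mult.assoc[symmetric])
qed simp

text \<open>
  The \<open>H\<^sup>2\<close>-component of \<open>z\<^sup>-\<^sup>n f\<close> tends to zero in norm.  For \<open>f = z\<^sup>k\<close> it is zero as soon as
  \<open>n > k\<close>, and the functions with this property form a closed subspace, since multiplication by
  \<open>z\<^sup>-\<^sup>n\<close> is isometric for every \<open>n\<close>.
\<close>
lemma shift_tends_to_zero_on_H2:
  assumes "f \<in> L2T" "e > 0"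
  shows "\<forall>\<^sub>F n in sequentially. \<forall>q\<in>H2.
    cmod (L2_inner (\<lambda>z. z powi (- int n) * f z) q) \<le> e * L2_norm q"
proof -
  define small where "small f e n \<longleftrightarrow>
    (\<forall>q\<in>H2. cmod (L2_inner (\<lambda>z. z powi (- int n) * f z) q) \<le> e * L2_norm q)"
    for f :: "complex \<Rightarrow> complex" and e and n :: nat
  have small_mono: "small f e' n" if "small f e n" "e \<le> e'" for f e e' n
    using that unfolding small_def by (meson L2_norm_nonneg mult_right_mono order_trans)
  have small_add: "small (\<lambda>z. f z + g z) (e + e') n"
    if "small f e n" "small g e' n" and L: "f \<in> L2T" "g \<in> L2T" for f g e e' n
    unfolding small_def
  proof
    fix q assume q: "q \<in> H2"
    have "L2_inner (\<lambda>z. z powi (- int n) * (f z + g z)) q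
        = L2_inner (\<lambda>z. z powi (- int n) * f z) q + L2_inner (\<lambda>z. z powi (- int n) * g z) q"
      unfolding distrib_left by (intro L2_inner_add_left L2T_shift L H2D q)
    also have "cmod \<dots> \<le> e * L2_norm q + e' * L2_norm q"
      using that q unfolding small_def by (intro norm_triangle_mono) auto
    finally show "cmod (L2_inner (\<lambda>z. z powi (- int n) * (f z + g z)) q) \<le> (e + e') * L2_norm q"
      by (simp add: distrib_right)
  qed
  have small_scale: "small (\<lambda>z. c * f z) (cmod c * e) n" if "small f e n" for f c e n
    unfolding small_def
  proof
    fix q assume q: "q \<in> H2"
    have "cmod (L2_inner (\<lambda>z. z powi (- int n) * (c * f z)) q)
        = cmod c * cmod (L2_inner (\<lambda>z. z powi (- int n) * f z) q)"
      using L2_inner_scale_left[of c "\<lambda>z. z powi (- int n) * f z" q]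
      by (simp add: mult.left_commute norm_mult)
    also have "\<dots> \<le> cmod c * (e * L2_norm q)"
      using that q unfolding small_def by (intro mult_left_mono) auto
    finally show "cmod (L2_inner (\<lambda>z. z powi (- int n) * (c * f z)) q) \<le> cmod c * e * L2_norm q"
      by (simp add: mult.assoc)
  qed
  have small_norm: "small f (L2_norm f) n" if f: "f \<in> L2T" for f n
    unfolding small_def
  proof
    fix q assume q: "q \<in> H2"
    have "cmod (L2_inner (\<lambda>z. z powi (- int n) * f z) q)
        \<le> L2_norm (\<lambda>z. z powi (- int n) * f z) * L2_norm q"
      by (intro L2_Cauchy_Schwarz L2T_shift f H2D q)
    also have "L2_norm (\<lambda>z. z powi (- int n) * f z) = L2_norm f"
      unfolding L2_norm_def
      by (intro arg_cong[where f = sqrt] Bochner_Integration.integral_cong)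
         (auto simp: norm_mult norm_power_int)
    finally show "cmod (L2_inner (\<lambda>z. z powi (- int n) * f z) q) \<le> L2_norm f * L2_norm q" .
  qed
  define N where "N = {f \<in> L2T. \<forall>e>0. \<forall>\<^sub>F n in sequentially. small f e n}"
  have N_I: "f \<in> N" if "f \<in> L2T" "\<And>e. e > 0 \<Longrightarrow> \<forall>\<^sub>F n in sequentially. small f e n" for f
    using that by (simp add: N_def)
  have N_L: "f \<in> L2T" and N_small: "e > 0 \<Longrightarrow> \<forall>\<^sub>F n in sequentially. small f e n" if "f \<in> N" for f e
    using that by (simp_all add: N_def)
  have powi: "(\<lambda>z. z powi k) \<in> N" for k
  proof (rule N_I)
    fix e :: real assume "e > 0"
    have "small (\<lambda>z. z powi k) e n" if "n > nat k" for n
      unfolding small_def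
    proof
      fix q assume q: "q \<in> H2"
      have "L2_inner q (\<lambda>z. z powi (- int n) * z powi k) = fourier_coeff (\<lambda>z. z powi (int n) * q z) k"
        unfolding fourier_coeff_def L2_inner_shift ..
      also have "\<dots> = 0"
        unfolding fourier_coeff_shift using that by (intro H2D(2)[OF q]) linarith
      finally have "L2_inner (\<lambda>z. z powi (- int n) * z powi k) q = 0"
        using L2_inner_commute[of _ q] by simp
      then show "cmod (L2_inner (\<lambda>z. z powi (- int n) * z powi k) q) \<le> e * L2_norm q"
        using \<open>e > 0\<close> by simp
    qed
    then show "\<forall>\<^sub>F n in sequentially. small (\<lambda>z. z powi k) e n"
      by (intro eventually_mono[OF eventually_gt_at_top[of "nat k"]])
  qed (rule L2T_powi)
  have scale: "(\<lambda>z. c * f z) \<in> N" if f: "f \<in> N" for f c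
  proof (rule N_I)
    fix e :: real assume "e > 0"
    have c: "cmod c + 1 > 0"
      by (simp add: add_nonneg_pos)
    then have "\<forall>\<^sub>F n in sequentially. small f (e / (cmod c + 1)) n"
      using \<open>e > 0\<close> by (intro N_small f) simp
    moreover have "cmod c * (e / (cmod c + 1)) \<le> e"
      using c \<open>e > 0\<close> by (simp add: field_simps)
    ultimately show "\<forall>\<^sub>F n in sequentially. small (\<lambda>z. c * f z) e n"
      by (auto elim!: eventually_mono intro: small_mono[OF small_scale])
  qed (intro L2T_scale N_L f)
  have "closed_subspace_L2 N"
    unfolding closed_subspace_L2_def
  proof (intro conjI ballI allI impI)
    show "N \<subseteq> L2T" using N_L by blast
    show "(\<lambda>_. 0) \<in> N"
      using scale[OF powi, of 0] by simp
    show "(\<lambda>z. f z + g z) \<in> N" if fg: "f \<in> N" "g \<in> N" for f g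
    proof (rule N_I)
      fix e :: real assume "e > 0"
      then have "e / 2 > 0" by simp
      with N_small[OF fg(1)] N_small[OF fg(2)]
      have "\<forall>\<^sub>F n in sequentially. small f (e / 2) n" "\<forall>\<^sub>F n in sequentially. small g (e / 2) n"
        by blast+
      then show "\<forall>\<^sub>F n in sequentially. small (\<lambda>z. f z + g z) e n"
      proof eventually_elim
        case (elim n)
        then show ?case
          using small_add[of f "e / 2" n g "e / 2"] N_L fg by simp
      qed
    qed (intro L2T_add N_L fg)
    show "(\<lambda>z. c * f z) \<in> N" if "f \<in> N" for f c
      by (rule scale[OF that])
    fix F :: "nat \<Rightarrow> complex \<Rightarrow> complex" and f
    assume f: "f \<in> L2T"
      and F: "(\<forall>n. F n \<in> N) \<and> (\<lambda>n. L2_norm (\<lambda>z. F n z - f z)) \<longlonglongrightarrow> 0"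
    show "f \<in> N"
    proof (rule N_I[OF f])
      fix e :: real assume e: "e > 0"
      then have "\<exists>m. L2_norm (\<lambda>z. F m z - f z) < e / 2"
        using LIMSEQ_D[OF conjunct2[OF F], of "e / 2"] by auto
      then obtain m where m: "L2_norm (\<lambda>z. F m z - f z) < e / 2" ..
      have FN: "F m \<in> N" using F by blast
      have L: "(\<lambda>z. f z - F m z) \<in> L2T"
        by (intro L2T_diff f N_L FN)
      have "L2_norm (\<lambda>z. f z - F m z) = L2_norm (\<lambda>z. F m z - f z)"
        by (simp add: L2_norm_def norm_minus_commute)
      then have diff: "small (\<lambda>z. f z - F m z) (e / 2) n" for n
        using small_mono[OF small_norm[OF L]] m by simp
      have "\<forall>\<^sub>F n in sequentially. small (F m) (e / 2) n"
        using e by (intro N_small FN) simp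
      then show "\<forall>\<^sub>F n in sequentially. small f e n"
      proof eventually_elim
        case (elim n)
        then show ?case
          using small_add[OF elim diff N_L[OF FN] L] by simp
      qed
    qed
  qed
  then have "f \<in> N"
    using powi assms(1) by (rule trigonometric_polynomials_dense)
  from N_small[OF this assms(2)] show ?thesis
    by (simp add: small_def)
qed

text \<open>
  This is the uniqueness theorem of F. and M. Riesz, proved by the wandering-subspace idea behind
  Beurling's theorem.  Suppose \<open>f \<noteq> 0\<close> and let \<open>N\<close> be the space of functions in \<open>H\<^sup>2\<close> that vanish
  wherever \<open>f\<close> does.  It is closed and invariant under multiplication by \<open>z\<close>, and it contains a
  function with nonzero mean, namely \<open>z\<^sup>-\<^sup>k f\<close> with \<open>k\<close> the order of the zero of \<open>f\<close> at the origin.  So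
  there is \<open>r \<in> N\<close> with nonzero mean that is orthogonal to the functions of mean zero in \<open>N\<close>, in
  particular to \<open>z\<^sup>n r\<close> for all \<open>n > 0\<close>.  Hence all Fourier coefficients of \<open>\<bar>r\<bar>\<^sup>2\<close> except the mean
  vanish and \<open>\<bar>r\<bar>\<close> is constant.  The constant is not zero, so \<open>r\<close>, and therefore \<open>f\<close>, has almost no
  zeros.
\<close>
theorem H2_zero_set_dichotomy:
  assumes f: "f \<in> H2" and zeros: "\<not> (AE z in circle_measure. f z \<noteq> 0)"
  shows "AE z in circle_measure. f z = 0"
proof (rule ccontr)
  assume nonzero: "\<not> (AE z in circle_measure. f z = 0)"
  note fL = H2D(1)[OF f]
  \<comment> \<open>With \<open>\<xi>\<close> the indicator of the zero set of \<open>f\<close>, the vanishing condition is the orthogonality to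
    all \<open>\<xi> k\<close>, which makes \<open>N\<close> and \<open>N0\<close> orthogonal complements and hence closed.\<close>
  define \<xi> :: "complex \<Rightarrow> complex" where "\<xi> z = (if f z = 0 then 1 else 0)" for z
  have \<xi>: "\<xi> \<in> LinfT"
    unfolding LinfT_def \<xi>_def using fL by (auto intro!: exI[of _ 1])
  define S where "S = {\<lambda>z. z powi n |n :: int. n < 0} \<union> {\<lambda>z. \<xi> z * k z |k. k \<in> L2T}"
  define N where "N = orth_in L2T S"
  define N0 where "N0 = orth_in L2T (insert (\<lambda>z. z powi 0) S)"
  have S: "S \<subseteq> L2T"
    using \<xi> by (auto simp: S_def L2T_powi L2T_mult_Linf)
  have N: "closed_subspace_L2 N" and N0: "closed_subspace_L2 N0"
    unfolding N_def N0_def using S L2T_powi[of 0] by (auto intro!: closed_subspace_orth_in)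
  have N_iff: "g \<in> N \<longleftrightarrow> g \<in> H2 \<and> (AE z in circle_measure. f z = 0 \<longrightarrow> g z = 0)" for g
  proof
    assume g: "g \<in> N"
    then have "g \<in> H2"
      by (auto simp: N_def S_def orth_in_def H2_eq_orth_in)
    then have gL: "g \<in> L2T" by (rule H2D)
    have "L2_inner (\<lambda>z. \<xi> z * g z) (\<lambda>z. \<xi> z * g z) = L2_inner g (\<lambda>z. \<xi> z * g z)"
      unfolding L2_inner_def \<xi>_def by (intro Bochner_Integration.integral_cong) auto
    also have "\<dots> = 0"
      using g gL by (auto simp: N_def S_def orth_in_def)
    finally have "AE z in circle_measure. \<xi> z * g z = 0"
      by (intro L2_norm_eq_0 L2T_mult_Linf gL \<xi>) (simp add: L2_inner_self)
    with \<open>g \<in> H2\<close> show "g \<in> H2 \<and> (AE z in circle_measure. f z = 0 \<longrightarrow> g z = 0)"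
      by (auto simp: \<xi>_def)
  next
    assume g: "g \<in> H2 \<and> (AE z in circle_measure. f z = 0 \<longrightarrow> g z = 0)"
    have gL: "g \<in> L2T" using g H2D by blast
    have "L2_inner g (\<lambda>z. \<xi> z * k z) = 0" if k: "k \<in> L2T" for k
    proof -
      have "L2_inner g (\<lambda>z. \<xi> z * k z) = L2_inner (\<lambda>z. cnj (\<xi> z) * g z) k"
        by (simp add: L2_inner_mult_left)
      also have "\<dots> = L2_inner (\<lambda>_. 0) k"
      proof (rule L2_inner_cong_AE)
        show "AE z in circle_measure. cnj (\<xi> z) * g z = 0"
          using conjunct2[OF g] by eventually_elim (simp add: \<xi>_def)
        show "(\<lambda>z. cnj (\<xi> z) * g z) \<in> borel_measurable circle_measure"
          by (intro L2T_measurable L2T_mult_Linf gL LinfT_cnj \<xi>)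
      qed (use k in \<open>auto simp: L2T_def\<close>)
      finally show ?thesis
        by (simp add: L2_inner_def)
    qed
    with g gL show "g \<in> N"
      by (auto simp: N_def S_def orth_in_def H2_def fourier_coeff_def)
  qed
  have N0_iff: "g \<in> N0 \<longleftrightarrow> g \<in> N \<and> fourier_coeff g 0 = 0" for g
    by (auto simp: N0_def N_def orth_in_def fourier_coeff_def)
  obtain n where n: "fourier_coeff f n \<noteq> 0"
    using fourier_uniqueness_L2[OF fL] nonzero by blast
  then have "n \<ge> 0"
    using H2D(2)[OF f, of n] by force
  with n have ex: "\<exists>k. fourier_coeff f (int k) \<noteq> 0"
    by (intro exI[of _ "nat n"]) simp
  define k where "k = (LEAST k. fourier_coeff f (int k) \<noteq> 0)"
  have k: "fourier_coeff f (int k) \<noteq> 0"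
    unfolding k_def by (rule LeastI_ex[OF ex])
  have less_k: "fourier_coeff f n = 0" if "n < int k" for n
  proof (cases "n < 0")
    case False
    then have "nat n < k" using that by simp
    from not_less_Least[OF this[unfolded k_def]] False show ?thesis
      by simp
  qed (use f in \<open>simp add: H2D\<close>)
  define f1 where "f1 z = z powi (- int k) * f z" for z
  have f1: "f1 \<in> N" "fourier_coeff f1 0 \<noteq> 0"
    using k less_k fL unfolding N_iff H2_def f1_def by (auto simp: fourier_coeff_shift L2T_shift)
  have f1L: "f1 \<in> L2T"
    by (rule closed_subspace_L2D(1)[OF N f1(1)])
  obtain p where p: "p \<in> N0" "\<And>g. g \<in> N0 \<Longrightarrow> L2_inner (\<lambda>z. f1 z - p z) g = 0"
    using orthogonal_decomposition[OF N0 f1L] by blast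
  define r where "r z = f1 z - p z" for z
  have r: "r \<in> N"
    unfolding r_def using p(1) by (intro closed_subspace_diff[OF N f1(1)]) (simp add: N0_iff)
  then have rH: "r \<in> H2" and r_zero: "AE z in circle_measure. f z = 0 \<longrightarrow> r z = 0"
    by (auto simp: N_iff)
  note rL = H2D(1)[OF rH]
  have shift: "L2_inner r (\<lambda>z. z powi n * r z) = 0" if n: "n > 0" for n
  proof -
    have "fourier_coeff (\<lambda>z. z powi n * r z) m = 0" if "m \<le> 0" for m
      unfolding fourier_coeff_shift using that n by (intro H2D(2)[OF rH]) simp
    then have "(\<lambda>z. z powi n * r z) \<in> N0"
      unfolding N0_iff N_iff H2_def using r_zero by (auto simp: L2T_shift rL)
    from p(2)[OF this] show ?thesis
      by (simp add: r_def[abs_def])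
  qed
  define c where "c = (L2_norm r)\<^sup>2"
  have int: "integrable circle_measure (\<lambda>z. r z * cnj (r z))"
    by (intro integrable_inner rL)
  have pos: "(\<integral>z. z powi n * (r z * cnj (r z)) \<partial>circle_measure) = 0" if "n \<noteq> 0" for n
  proof -
    have eq: "(\<integral>z. z powi (-m) * (r z * cnj (r z)) \<partial>circle_measure) = L2_inner r (\<lambda>z. z powi m * r z)" for m
      unfolding L2_inner_def
      by (intro Bochner_Integration.integral_cong) (simp_all add: cnj_powi_circle del: complex_cnj_power_int)
    consider "n < 0" | "n > 0" using \<open>n \<noteq> 0\<close> by linarith
    then show ?thesis
    proof cases
      case 1
      then show ?thesis using eq[of "-n"] shift[of "-n"] by simp
    next
      case 2
      have "(\<integral>z. z powi n * (r z * cnj (r z)) \<partial>circle_measure)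
          = cnj (\<integral>z. z powi (-n) * (r z * cnj (r z)) \<partial>circle_measure)"
        unfolding Bochner_Integration.integral_cnj[symmetric]
        by (intro Bochner_Integration.integral_cong)
           (simp_all add: cnj_powi_circle mult.commute[of "cnj (r _)"] del: complex_cnj_power_int)
      then show ?thesis using eq[of n] shift[OF 2] by simp
    qed
  qed
  have "AE z in circle_measure. r z * cnj (r z) - complex_of_real c = 0"
  proof (rule fourier_uniqueness)
    show "integrable circle_measure (\<lambda>z. r z * cnj (r z) - complex_of_real c)"
      by (intro Bochner_Integration.integrable_diff int) simp
    fix n
    have "fourier_coeff (\<lambda>z. r z * cnj (r z) - complex_of_real c) n
        = (\<integral>z. z powi (-n) * (r z * cnj (r z)) - complex_of_real c * z powi (-n) \<partial>circle_measure)"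
      by (simp add: fourier_coeff_eq right_diff_distrib mult.commute)
    also have "\<dots> = (\<integral>z. z powi (-n) * (r z * cnj (r z)) \<partial>circle_measure)
        - complex_of_real c * (\<integral>z. z powi (-n) \<partial>circle_measure)"
      using integrable_mult_Linf[OF int LinfT_powi] L1_norm_le_L2_norm(1)[OF L2T_powi]
      by (subst Bochner_Integration.integral_diff) auto
    also have "\<dots> = 0"
    proof (cases "n = 0")
      case True
      then show ?thesis
        using L2_inner_self[of r] by (simp add: L2_inner_def c_def)
    qed (use pos[of "-n"] integral_powi_circle[of "-n"] in simp)
    finally show "fourier_coeff (\<lambda>z. r z * cnj (r z) - complex_of_real c) n = 0" .
  qed
  then have const: "AE z in circle_measure. (cmod (r z))\<^sup>2 = c"
  proof eventually_elim
    case (elim z)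
    then have "complex_of_real ((cmod (r z))\<^sup>2) = complex_of_real c"
      unfolding complex_norm_square by simp
    then show ?case
      by (simp only: of_real_eq_iff)
  qed
  have "c = 0"
  proof (rule ccontr)
    assume c: "c \<noteq> 0"
    have "AE z in circle_measure. f z \<noteq> 0"
      using const r_zero by eventually_elim (use c in auto)
    with zeros show False ..
  qed
  then have "AE z in circle_measure. r z = 0"
    using L2_norm_eq_0[OF rL] by (simp add: c_def)
  then have "fourier_coeff r 0 = L2_inner (\<lambda>_. 0) (\<lambda>z. z powi 0)"
    unfolding fourier_coeff_def using rL by (intro L2_inner_cong_AE) (auto simp: L2T_def)
  then have "fourier_coeff r 0 = 0"
    by (simp add: L2_inner_def)
  moreover have "fourier_coeff r 0 = fourier_coeff f1 0 - fourier_coeff p 0"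
    unfolding fourier_coeff_def r_def
    by (intro L2_inner_diff_left f1L L2T_powi closed_subspace_L2D(1)[OF N0 p(1)])
  ultimately show False
    using f1(2) p(1) by (simp add: N0_iff)
qed

section \<open>Projection onto an orthogonal complement\<close>

lemma L2_norm_mult_Linf:
  assumes "\<phi> \<in> LinfT"
  obtains C where "C \<ge> 0" "\<And>f. f \<in> L2T \<Longrightarrow> L2_norm (\<lambda>z. \<phi> z * f z) \<le> C * L2_norm f"
proof -
  obtain C where C: "AE z in circle_measure. cmod (\<phi> z) \<le> C"
    using assms by (auto simp: LinfT_def)
  have "L2_norm (\<lambda>z. \<phi> z * f z) \<le> \<bar>C\<bar> * L2_norm f" if f: "f \<in> L2T" for f
  proof (rule power2_le_imp_le)
    have "(L2_norm (\<lambda>z. \<phi> z * f z))\<^sup>2 \<le> (\<integral>z. C\<^sup>2 * (cmod (f z))\<^sup>2 \<partial>circle_measure)"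
      unfolding L2_norm_sq
    proof (rule integral_mono_AE)
      show "integrable circle_measure (\<lambda>z. (cmod (\<phi> z * f z))\<^sup>2)"
        by (intro L2T_integrable_sq L2T_mult_Linf f assms)
      show "integrable circle_measure (\<lambda>z. C\<^sup>2 * (cmod (f z))\<^sup>2)"
        by (intro integrable_mult_right L2T_integrable_sq f)
      show "AE z in circle_measure. (cmod (\<phi> z * f z))\<^sup>2 \<le> C\<^sup>2 * (cmod (f z))\<^sup>2"
        using C by eventually_elim (auto simp: norm_mult power_mult_distrib intro!: mult_right_mono power_mono)
    qed
    also have "\<dots> = (\<bar>C\<bar> * L2_norm f)\<^sup>2"
      by (simp add: power_mult_distrib L2_norm_sq)
    finally show "(L2_norm (\<lambda>z. \<phi> z * f z))\<^sup>2 \<le> (\<bar>C\<bar> * L2_norm f)\<^sup>2" .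
  qed simp
  then show ?thesis
    by (intro that[of "\<bar>C\<bar>"]) auto
qed

lemma L2_norm_powi: "L2_norm (\<lambda>z. z powi n) = 1"
proof -
  have "L2_norm (\<lambda>z. z powi n) = L2_norm (\<lambda>_. 1)"
    unfolding L2_norm_def
    by (intro arg_cong[where f = sqrt] Bochner_Integration.integral_cong) (auto simp: norm_power_int)
  then show ?thesis
    by (simp add: L2_norm_one)
qed

lemma orth_inD: "f \<in> orth_in L2T M \<Longrightarrow> f \<in> L2T" "f \<in> orth_in L2T M \<Longrightarrow> g \<in> M \<Longrightarrow> L2_inner f g = 0"
  by (auto simp: orth_in_def)

text \<open>
  Although \<open>orth_proj\<close> is a choice, the decomposition of \<open>f\<close> along \<open>M\<close> shows that a projection onto
  \<open>M\<^sup>\<bottom>\<close> exists, and any other one differs from it by an element of \<open>M\<^sup>\<bottom>\<close> orthogonal to \<open>M\<^sup>\<bottom>\<close>.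
  Thus the complementary part lies in \<open>M\<close> itself, that is \<open>M\<^sup>\<bottom>\<^sup>\<bottom> = M\<close>.
\<close>
lemma orth_proj_complement:
  assumes M: "closed_subspace_L2 M" and f: "f \<in> L2T"
  shows "orth_proj (orth_in L2T M) f \<in> orth_in L2T M"
    and "(\<lambda>z. f z - orth_proj (orth_in L2T M) f z) \<in> M"
proof -
  let ?P = "\<lambda>p. p \<in> orth_in L2T M \<and> (\<forall>g\<in>orth_in L2T M. L2_inner (\<lambda>z. f z - p z) g = 0)"
  obtain q where q: "q \<in> M" "\<And>g. g \<in> M \<Longrightarrow> L2_inner (\<lambda>z. f z - q z) g = 0"
    using orthogonal_decomposition[OF M f] by blast
  have qL: "q \<in> L2T"
    by (rule closed_subspace_L2D(1)[OF M q(1)])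
  define p0 where "p0 z = f z - q z" for z
  have p0: "p0 \<in> orth_in L2T M"
    using q qL f by (simp add: orth_in_def p0_def[abs_def] L2T_diff)
  have q_orth: "L2_inner q g = 0" if "g \<in> orth_in L2T M" for g
    using L2_inner_commute[of g q] orth_inD(2)[OF that q(1)] by simp
  have "?P p0"
    using p0 q_orth by (simp add: p0_def)
  then have P: "?P (orth_proj (orth_in L2T M) f)"
    unfolding orth_proj_def by (rule someI[of ?P])
  define p where "p = orth_proj (orth_in L2T M) f"
  have p: "p \<in> orth_in L2T M" "\<And>g. g \<in> orth_in L2T M \<Longrightarrow> L2_inner (\<lambda>z. f z - p z) g = 0"
    using P unfolding p_def by blast+
  show "orth_proj (orth_in L2T M) f \<in> orth_in L2T M"
    using P by blast
  have pL: "p \<in> L2T" "p0 \<in> L2T"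
    using p(1) p0 orth_inD by blast+
  define r where "r z = q z - (f z - p z)" for z
  have r: "r = (\<lambda>z. p z - p0 z)"
    by (simp add: r_def p0_def fun_eq_iff)
  have "M \<subseteq> L2T"
    using closed_subspace_L2D(1)[OF M] by blast
  then have r_orth: "r \<in> orth_in L2T M"
    unfolding r by (intro closed_subspace_diff[OF closed_subspace_orth_in] p(1) p0)
  have "L2_inner r r = L2_inner q r - L2_inner (\<lambda>z. f z - p z) r"
    using r_orth unfolding r_def[abs_def]
    by (intro L2_inner_diff_left L2T_diff qL f pL)
  also have "\<dots> = 0"
    using q_orth[OF r_orth] p(2)[OF r_orth] by simp
  finally have "AE z in circle_measure. r z = 0"
    by (intro L2_norm_eq_0 orth_inD(1)[OF r_orth]) (simp add: L2_inner_self)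
  then have "AE z in circle_measure. f z - p z = q z"
    by eventually_elim (simp add: r_def)
  moreover have "(\<lambda>z. f z - p z) \<in> borel_measurable circle_measure"
    by (intro L2T_measurable L2T_diff f pL)
  ultimately have "(\<lambda>z. f z - p z) \<in> M"
    by (intro closed_subspace_AE[OF M q(1)])
  then show "(\<lambda>z. f z - orth_proj (orth_in L2T M) f z) \<in> M"
    by (simp add: p_def)
qed

lemma orth_proj_complement_zero:
  assumes M: "closed_subspace_L2 M" and f: "f \<in> L2T" "AE z in circle_measure. f z = 0"
  shows "AE z in circle_measure. orth_proj (orth_in L2T M) f z = 0"
proof -
  define p where "p = orth_proj (orth_in L2T M) f"
  note p = orth_proj_complement[OF M f(1), folded p_def]
  note pL = orth_inD(1)[OF p(1)]
  have "L2_inner (\<lambda>z. f z - p z) p = 0"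
    using L2_inner_commute[of p "\<lambda>z. f z - p z"] orth_inD(2)[OF p] by simp
  then have "L2_inner p p = L2_inner f p"
    by (simp add: L2_inner_diff_left f pL)
  also have "\<dots> = L2_inner (\<lambda>_. 0) p"
    using f pL by (intro L2_inner_cong_AE) (auto simp: L2T_def)
  also have "\<dots> = 0"
    by (simp add: L2_inner_def)
  finally show ?thesis
    unfolding p_def[symmetric] by (intro L2_norm_eq_0 pL) (simp add: L2_inner_self)
qed

section \<open>Products of dual Toeplitz operators\<close>

text \<open>
  Both \<open>g\<close> and \<open>\<phi> g\<close> obey the zero set dichotomy: the zeros of \<open>\<phi>\<close> force \<open>\<phi> g = 0\<close>, and then the
  nonzero values of \<open>\<phi>\<close> force \<open>g = 0\<close>.
\<close>
lemma H2_multiplier_zero: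
  assumes "g \<in> H2" "(\<lambda>z. \<phi> z * g z) \<in> H2"
    and "\<not> (AE z in circle_measure. \<phi> z \<noteq> 0)" "\<not> (AE z in circle_measure. \<phi> z = 0)"
  shows "AE z in circle_measure. g z = 0"
proof (rule H2_zero_set_dichotomy[OF assms(1)])
  have "\<not> (AE z in circle_measure. \<phi> z * g z \<noteq> 0)"
  proof
    assume "AE z in circle_measure. \<phi> z * g z \<noteq> 0"
    then have "AE z in circle_measure. \<phi> z \<noteq> 0"
      by eventually_elim auto
    with assms(3) show False ..
  qed
  from H2_zero_set_dichotomy[OF assms(2) this]
  have zero: "AE z in circle_measure. \<phi> z * g z = 0" .
  show "\<not> (AE z in circle_measure. g z \<noteq> 0)"
  proof
    assume "AE z in circle_measure. g z \<noteq> 0"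
    with zero have "AE z in circle_measure. \<phi> z = 0"
      by eventually_elim auto
    with assms(4) show False ..
  qed
qed

lemma powi_orthogonal_H2:
  assumes "M \<subseteq> H2" "n < 0"
  shows "(\<lambda>z. z powi n) \<in> orth_in L2T M"
proof -
  have "L2_inner (\<lambda>z. z powi n) g = 0" if "g \<in> M" for g
    using L2_inner_commute[of "\<lambda>z. z powi n" g] H2D(2)[of g n] that assms
    by (auto simp: fourier_coeff_def)
  then show ?thesis
    by (simp add: orth_in_def L2T_powi)
qed

text \<open>
  The hypothesis on the product of operators in terms of \<open>M\<close> alone: \<open>q\<close> is the component of \<open>\<psi> f\<close>
  in \<open>M\<close>, and the other component is mapped into \<open>M\<close> by \<open>\<phi>\<close>.
\<close>
lemma dual_toeplitz_product_zero_decomposition: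
  assumes M: "closed_subspace_L2 M" "M \<subseteq> H2"
    and \<phi>: "\<phi> \<in> LinfT" and \<psi>: "\<psi> \<in> LinfT"
    and zero: "\<forall>f \<in> orth_in L2T M. AE z in circle_measure.
      dual_toeplitz M \<phi> (dual_toeplitz M \<psi> f) z = 0"
    and f: "f \<in> orth_in L2T M"
  obtains q where "q \<in> M" "(\<lambda>z. \<psi> z * f z - q z) \<in> orth_in L2T M" "(\<lambda>z. \<phi> z * (\<psi> z * f z - q z)) \<in> M"
proof -
  define p where "p = dual_toeplitz M \<psi> f"
  have \<psi>f: "(\<lambda>z. \<psi> z * f z) \<in> L2T"
    by (intro L2T_mult_Linf \<psi> orth_inD(1)[OF f])
  note p = orth_proj_complement[OF M(1) \<psi>f, folded dual_toeplitz_def, folded p_def]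
  have \<phi>p: "(\<lambda>z. \<phi> z * p z) \<in> L2T"
    by (intro L2T_mult_Linf \<phi> orth_inD(1)[OF p(1)])
  note r = orth_proj_complement(2)[OF M(1) \<phi>p, folded dual_toeplitz_def]
  have "AE z in circle_measure. \<phi> z * p z = \<phi> z * p z - dual_toeplitz M \<phi> p z"
    using bspec[OF zero f] unfolding p_def[symmetric] by eventually_elim simp
  then have "(\<lambda>z. \<phi> z * p z) \<in> M"
    by (rule closed_subspace_AE[OF M(1) r L2T_measurable[OF \<phi>p]])
  then show ?thesis
    using p by (intro that[of "\<lambda>z. \<psi> z * f z - p z"]) simp_all
qed

text \<open>
  Take \<open>f = z\<^sup>-\<^sup>n\<close>, which is orthogonal to \<open>M\<close>.  The component \<open>q\<close> of \<open>\<psi> z\<^sup>-\<^sup>n\<close> in \<open>M\<close> is small for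
  large \<open>n\<close>, and \<open>\<phi> \<psi> z\<^sup>-\<^sup>n - \<phi> q\<close> has no negative Fourier coefficients.  So the coefficient of
  \<open>\<phi> \<psi>\<close> at \<open>k\<close> equals that of \<open>\<phi> q\<close> at \<open>k - n < 0\<close>, which is as small as \<open>q\<close>.
\<close>
theorem dual_toeplitz_product_zero_symbols:
  assumes M: "closed_subspace_L2 M" "M \<subseteq> H2"
    and \<phi>: "\<phi> \<in> LinfT" and \<psi>: "\<psi> \<in> LinfT"
    and zero: "\<forall>f \<in> orth_in L2T M. AE z in circle_measure.
      dual_toeplitz M \<phi> (dual_toeplitz M \<psi> f) z = 0"
  shows "AE z in circle_measure. \<phi> z * \<psi> z = 0"
proof (rule fourier_uniqueness_L2)
  note split = dual_toeplitz_product_zero_decomposition[OF M \<phi> \<psi> zero]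
  have \<psi>L: "\<psi> \<in> L2T"
    by (intro LinfT_subset_L2T \<psi>)
  show L: "(\<lambda>z. \<phi> z * \<psi> z) \<in> L2T"
    by (intro L2T_mult_Linf \<phi> \<psi>L)
  obtain C where C: "C \<ge> 0" "\<And>f. f \<in> L2T \<Longrightarrow> L2_norm (\<lambda>z. \<phi> z * f z) \<le> C * L2_norm f"
    using L2_norm_mult_Linf[OF \<phi>] by blast
  fix k
  have bound: "cmod (fourier_coeff (\<lambda>z. \<phi> z * \<psi> z) k) \<le> C * e" if e: "e > 0" for e
  proof -
    have "\<forall>\<^sub>F n in sequentially. nat k < n \<and>
        (\<forall>q\<in>H2. cmod (L2_inner (\<lambda>z. z powi (- int n) * \<psi> z) q) \<le> e * L2_norm q)"
      using eventually_gt_at_top shift_tends_to_zero_on_H2[OF \<psi>L e] by (rule eventually_conj)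
    then obtain n where n: "nat k < n"
      and small: "\<And>q. q \<in> H2 \<Longrightarrow> cmod (L2_inner (\<lambda>z. z powi (- int n) * \<psi> z) q) \<le> e * L2_norm q"
      by (auto dest: eventually_happens)
    have "(\<lambda>z. z powi (- int n)) \<in> orth_in L2T M"
      using n by (intro powi_orthogonal_H2 M) simp
    then obtain q where q: "q \<in> M" "(\<lambda>z. \<psi> z * z powi (- int n) - q z) \<in> orth_in L2T M"
        "(\<lambda>z. \<phi> z * (\<psi> z * z powi (- int n) - q z)) \<in> M"
      by (erule split)
    have qH: "q \<in> H2" and qL: "q \<in> L2T"
      using q(1) M(2) H2D by blast+
    have \<psi>n: "(\<lambda>z. z powi (- int n) * \<psi> z) \<in> L2T"
      by (intro L2T_shift \<psi>L)
    have "L2_inner (\<lambda>z. z powi (- int n) * \<psi> z) q = L2_inner q q"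
      using orth_inD(2)[OF q(2,1)] L2_inner_diff_left[OF \<psi>n qL qL] by (simp add: mult.commute)
    then have "(L2_norm q)\<^sup>2 \<le> e * L2_norm q"
      using small[OF qH] by (simp add: L2_inner_self norm_power)
    then have q_small: "L2_norm q \<le> e"
      using e L2_norm_nonneg[of q] by (cases "L2_norm q = 0") (simp_all add: power2_eq_square)
    have "0 = fourier_coeff (\<lambda>z. \<phi> z * (\<psi> z * z powi (- int n) - q z)) (k - int n)"
      using q(3) M(2) n by (intro H2D(2)[symmetric]) auto
    also have "\<dots> = fourier_coeff (\<lambda>z. z powi (- int n) * (\<phi> z * \<psi> z) - \<phi> z * q z) (k - int n)"
      by (simp add: algebra_simps)
    also have "\<dots> = fourier_coeff (\<lambda>z. z powi (- int n) * (\<phi> z * \<psi> z)) (k - int n)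
        - fourier_coeff (\<lambda>z. \<phi> z * q z) (k - int n)"
      unfolding fourier_coeff_def
      by (intro L2_inner_diff_left L2T_shift L L2T_mult_Linf qL \<phi> L2T_powi)
    finally have "fourier_coeff (\<lambda>z. \<phi> z * \<psi> z) k = fourier_coeff (\<lambda>z. \<phi> z * q z) (k - int n)"
      by (simp add: fourier_coeff_shift)
    also have "cmod \<dots> \<le> L2_norm (\<lambda>z. \<phi> z * q z) * L2_norm (\<lambda>z. z powi (k - int n))"
      unfolding fourier_coeff_def by (intro L2_Cauchy_Schwarz L2T_mult_Linf qL \<phi> L2T_powi)
    also have "\<dots> \<le> C * L2_norm q"
      using C(2)[OF qL] by (simp add: L2_norm_powi)
    also have "\<dots> \<le> C * e"
      using q_small C(1) by (rule mult_left_mono)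
    finally show ?thesis .
  qed
  have "cmod (fourier_coeff (\<lambda>z. \<phi> z * \<psi> z) k) \<le> 0"
  proof (rule field_le_epsilon)
    fix e :: real assume "e > 0"
    then have "cmod (fourier_coeff (\<lambda>z. \<phi> z * \<psi> z) k) \<le> C * (e / (C + 1))"
      using C(1) by (intro bound) simp
    also have "\<dots> \<le> e"
      using C(1) \<open>e > 0\<close> by (simp add: field_simps)
    finally show "cmod (fourier_coeff (\<lambda>z. \<phi> z * \<psi> z) k) \<le> 0 + e"
      by simp
  qed
  then show "fourier_coeff (\<lambda>z. \<phi> z * \<psi> z) k = 0"
    by simp
qed

text \<open>
  If neither symbol is zero, then both have many zeros because \<open>\<phi> \<psi> = 0\<close>.  Two applications of
  \<open>H2_multiplier_zero\<close> follow: to \<open>\<phi>\<close>, which shows that \<open>\<psi>\<close> maps \<open>M\<^sup>\<bottom>\<close> into itself, and then to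
  \<open>cnj \<psi>\<close>, which maps \<open>M\<close> into \<open>H\<^sup>2\<close> by duality.
\<close>
theorem dual_toeplitz_product_zero:
  assumes M: "closed_subspace_L2 M" "M \<subseteq> H2" "\<exists>f\<in>M. \<not> (AE z in circle_measure. f z = 0)"
    and \<phi>: "\<phi> \<in> LinfT" and \<psi>: "\<psi> \<in> LinfT"
  shows "(\<forall>f \<in> orth_in L2T M. AE z in circle_measure.
            dual_toeplitz M \<phi> (dual_toeplitz M \<psi> f) z = 0)
         \<longleftrightarrow> (AE z in circle_measure. \<phi> z = 0) \<or> (AE z in circle_measure. \<psi> z = 0)"
    (is "?zero \<longleftrightarrow> ?\<phi>0 \<or> ?\<psi>0")
proof
  assume zero: ?zero
  note split = dual_toeplitz_product_zero_decomposition[OF M(1,2) \<phi> \<psi> zero]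
  have prod: "AE z in circle_measure. \<phi> z * \<psi> z = 0"
    by (rule dual_toeplitz_product_zero_symbols[OF M(1,2) \<phi> \<psi> zero])
  show "?\<phi>0 \<or> ?\<psi>0"
  proof (rule ccontr)
    assume "\<not> (?\<phi>0 \<or> ?\<psi>0)"
    then have nz: "\<not> ?\<phi>0" "\<not> ?\<psi>0" by auto
    have \<phi>_zeros: "\<not> (AE z in circle_measure. \<phi> z \<noteq> 0)"
    proof
      assume "AE z in circle_measure. \<phi> z \<noteq> 0"
      with prod have ?\<psi>0 by eventually_elim auto
      with nz show False by blast
    qed
    have \<psi>_zeros: "\<not> (AE z in circle_measure. \<psi> z \<noteq> 0)"
    proof
      assume "AE z in circle_measure. \<psi> z \<noteq> 0"
      with prod have ?\<phi>0 by eventually_elim auto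
      with nz show False by blast
    qed
    have invariant: "(\<lambda>z. \<psi> z * f z) \<in> orth_in L2T M" if f: "f \<in> orth_in L2T M" for f
    proof -
      obtain q where q: "q \<in> M" "(\<lambda>z. \<psi> z * f z - q z) \<in> orth_in L2T M"
          "(\<lambda>z. \<phi> z * (\<psi> z * f z - q z)) \<in> M"
        by (rule split[OF f])
      have qL: "q \<in> L2T"
        by (rule closed_subspace_L2D(1)[OF M(1) q(1)])
      \<comment> \<open>Since \<open>\<phi> \<psi> = 0\<close>, the element \<open>\<phi> (\<psi> f - q)\<close> of \<open>M\<close> is \<open>- \<phi> q\<close>.\<close>
      have "AE z in circle_measure. \<phi> z * q z = - 1 * (\<phi> z * (\<psi> z * f z - q z))"
        using prod by eventually_elim (auto simp: algebra_simps)
      then have "(\<lambda>z. \<phi> z * q z) \<in> M"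
        by (intro closed_subspace_AE[OF M(1) closed_subspace_L2D(4)[OF M(1) q(3), of "-1"]]
            L2T_measurable L2T_mult_Linf qL \<phi>)
      then have "AE z in circle_measure. q z = 0"
        using q(1) M(2) \<phi>_zeros nz by (intro H2_multiplier_zero[of q \<phi>]) auto
      then have "AE z in circle_measure. \<psi> z * f z = \<psi> z * f z - q z"
        by eventually_elim simp
      moreover have "M \<subseteq> L2T"
        using closed_subspace_L2D(1)[OF M(1)] by blast
      ultimately show ?thesis
        by (intro closed_subspace_AE[OF closed_subspace_orth_in q(2)]
            L2T_measurable L2T_mult_Linf \<psi> orth_inD(1)[OF f])
    qed
    have "AE z in circle_measure. m z = 0" if m: "m \<in> M" for m
    proof (rule H2_multiplier_zero)
      show "m \<in> H2"
        using m M(2) by blast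
      have "fourier_coeff (\<lambda>z. cnj (\<psi> z) * m z) n = 0" if "n < 0" for n
      proof -
        have "(\<lambda>z. \<psi> z * z powi n) \<in> orth_in L2T M"
          by (intro invariant powi_orthogonal_H2 M that)
        then have "L2_inner (\<lambda>z. \<psi> z * z powi n) m = 0"
          using m by (rule orth_inD(2))
        then show ?thesis
          using L2_inner_commute[of m "\<lambda>z. \<psi> z * z powi n"]
          by (simp add: fourier_coeff_def L2_inner_mult_left)
      qed
      then show "(\<lambda>z. cnj (\<psi> z) * m z) \<in> H2"
        using \<open>m \<in> H2\<close> by (auto simp: H2_def intro!: L2T_mult_Linf LinfT_cnj \<psi>)
    qed (use \<psi>_zeros nz in simp_all)
    then have "\<forall>m\<in>M. AE z in circle_measure. m z = 0" ..
    with M(3) show False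
      by (meson bexE bspec)
  qed
next
  assume symbols: "?\<phi>0 \<or> ?\<psi>0"
  show ?zero
  proof
    fix f assume f: "f \<in> orth_in L2T M"
    have \<psi>f: "(\<lambda>z. \<psi> z * f z) \<in> L2T"
      by (intro L2T_mult_Linf \<psi> orth_inD(1)[OF f])
    define p where "p = dual_toeplitz M \<psi> f"
    have "p \<in> L2T"
      using orth_inD(1)[OF orth_proj_complement(1)[OF M(1) \<psi>f]] by (simp add: p_def dual_toeplitz_def)
    then have \<phi>p: "(\<lambda>z. \<phi> z * p z) \<in> L2T"
      by (intro L2T_mult_Linf \<phi>)
    have "AE z in circle_measure. \<phi> z * p z = 0"
      using symbols
    proof
      assume ?\<phi>0
      then show ?thesis by eventually_elim simp
    next
      assume ?\<psi>0
      then have "AE z in circle_measure. \<psi> z * f z = 0"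
        by eventually_elim simp
      from orth_proj_complement_zero[OF M(1) \<psi>f this] show ?thesis
        unfolding p_def dual_toeplitz_def by eventually_elim simp
    qed
    from orth_proj_complement_zero[OF M(1) \<phi>p this]
    show "AE z in circle_measure. dual_toeplitz M \<phi> (dual_toeplitz M \<psi> f) z = 0"
      by (simp add: p_def[symmetric] dual_toeplitz_def[of M \<phi>])
  qed
qed

text \<open>
  A nearly invariant subspace is by definition a closed subspace contained in \<open>H\<^sup>2\<close>.
\<close>
theorem theorem4p6:
  fixes M :: "(complex \<Rightarrow> complex) set" and h u \<phi> \<psi> :: "complex \<Rightarrow> complex"
  assumes "nearly_invariant M"
    and "\<exists>f\<in>M. \<not> (AE z in circle_measure. f z = 0)"
    and "M \<noteq> H2"
    and "inner_function u"
    and "\<not> (\<exists>c. AE z in circle_measure. u z = c)"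
    and "disk_ext u 0 = 0"
    and "extremal_function M h"
    and "mult_isometry_onto h (model_space u) M"
    and "\<phi> \<in> LinfT" and "\<psi> \<in> LinfT"
  shows "(\<forall>f \<in> orth_in L2T M. AE z in circle_measure.
            dual_toeplitz M \<phi> (dual_toeplitz M \<psi> f) z = 0)
         \<longleftrightarrow> (AE z in circle_measure. \<phi> z = 0) \<or> (AE z in circle_measure. \<psi> z = 0)"
  using assms unfolding nearly_invariant_def
  by (intro dual_toeplitz_product_zero) simp_all

end
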